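(* Assume that the dynamics and the feedback operator satisfy the standing structural assumptions listed in the context (linear dissipation, $H$-dissipativity, nonlinearity assumption, feedback operator assumption). Let $F(z)=f-\nu Az-N(z)$, let $F_M$ be the cutoff-extended surrogate drift defined in the context (with $\widehat F_M$ locally Lipschitz on an open neighborhood of $\{z:\|z\|_V\le R_{\rm ext}^+\}$ and $F_{\rm diss}(z)=f-Bz$, $B$ symmetric positive definite), and let $\mu>0$. Suppose: (a) (global dissipativity) there are $\alpha_M>0$, $\beta_M\ge0$ with $\langle F_M(z),z\rangle_H\le\beta_M-\alpha_M\|z\|_H^2$ for all $z\in\mathbb R^d$, and $\alpha_M-\mu C_I>0$; (b) (global squeezing) there is $C_{M,\rm gl}\ge0$ with $\langle F_M(z')-F_M(z),z'-z\rangle_H\le-\nu\|z'-z\|_V^2+C_{M,\rm gl}\|z'-z\|_H^2$ for all $z,z'\in\mathbb R^d$. Let $(u_0,v_0)\in\mathbb R^d\times\mathbb R^d$, let $u$ be the global solution of $\dot u=F(u)$, $u(0)=u_0$, and let $v$ be the unique global adapted strong solution of $$dv=\bigl(F_M(v)-\mu(I_hv-I_hu)\bigr)dt+\mu\Gamma_h\,dW_t,\qquad v(0)=v_0 .$$ Let $T_\ast\ge0$, $R_\ast>0$ be common post-absorption constants as described in the context, $\mathcal B_\ast:=\{z:\|z\|_V\le R_\ast\}$, and suppose $\delta_M:=\sup_{z\in\mathcal B_\ast}\|F_M(z)-F(z)\|_H<\infty$. If $$\mu>2C_{M,\rm gl},\qquad \mu c_0^2h^2<\nu,$$ then, with $\gamma_{M,\rm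 gl}:=\mu-2C_{M,\rm gl}>0$ and $\nu_{\rm eff}:=\nu-\frac{\mu c_0^2h^2}{2}>0$, for every $t\ge T_\ast$, $$\mathbb E\|v(t)-u(t)\|_H^2\le e^{-\gamma_{M,\rm gl}(t-T_\ast)}\,\mathbb E\|v(T_\ast)-u(T_\ast)\|_H^2+\frac{1-e^{-\gamma_{M,\rm gl}(t-T_\ast)}}{\gamma_{M,\rm gl}}\left(\frac{\delta_M^2}{\lambda_1\nu_{\rm eff}}+\mu^2\operatorname{Tr}(\Gamma_h\Gamma_h^\top)\right).$$ Consequently, $$\limsup_{t\to\infty}\mathbb E\|v(t)-u(t)\|_H^2\le\frac1{\gamma_{M,\rm gl}}\left(\frac{\delta_M^2}{\lambda_1\nu_{\rm eff}}+\mu^2\operatorname{Tr}(\Gamma_h\Gamma_h^\top)\right).$$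
   Context: $H=\mathbb R^d$ with Euclidean inner product $\langle z,z'\rangle_H=z^\top z'$ and norm $\|\cdot\|_H$. $\nu>0$, $f\in\mathbb R^d$, $A\in\mathbb R^{d\times d}$, $N:\mathbb R^d\to\mathbb R^d$. Standing structural assumptions. - Linear dissipation: $A$ is symmetric positive definite; $\lambda_1>0$ is its smallest eigenvalue, and $\|z\|_V:=\sqrt{z^\top Az}$. - $H$-dissipativity: there are $\alpha>0$, $\beta\ge0$ with $\nu z^\top Az+\langle N(z),z\rangle_H\ge \alpha\|z\|_H^2-\beta$ for all $z\in\mathbb R^d$. - Nonlinearity: $N$ is locally Lipschitz; there is $C_{\mathrm E}\ge0$ with $\langle N(z),z\rangle_H\ge -C_{\mathrm E}\|z\|_H^2$ for all $z$; and for every $R>0$ there is $C_R\ge0$ with $-\langle N(z')-N(z),z'-z\rangle_H\le C_R\|z'-z\|_H^2$ whenever $\|z\|_H,\|z'\|_H\le R$. - Feedback operator: for each $h\in[0,1]$, $I_h:\mathbb R^d\to\mathbb R^d$ is linear and $\|z-I_hz\|_H\le c_0h\|z\|_V$ for all $z$, with $c_0>0$ independent of $z,h$. $C_I>0$ denotes a constant, independent of $h$, with $\|I_hz\|_H\le C_I\|z\|_H$ for all $z$. Here $h\in[0,1]$ is fixed. Cutoff-extended surrogate. Fix $R_{\rm ext}^+>R_{\rm ext}>0$ and $\psi\in C^\infty([0,\infty);[0,1])$ with $\psi(r)=1$ for $r\le R_{\rm ext}^2$ and $\psi(r)=0$ for $r\ge (R_{\rm ext}^+)^2$; put $\chi(z):=\psi(\|z\|_V^2)$.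 Given $\widehat F_M$ ($\mathbb R^d$-valued, defined on an open neighborhood of $\{z:\|z\|_V\le R_{\rm ext}^+\}$), set $F_M(z):=\chi(z)\widehat F_M(z)+(1-\chi(z))(f-Bz)$, the first term being $0$ wherever $\chi=0$. Common post-absorption constants. Let $\bar v$ be the solution of the noise-free surrogate nudged equation $\dot{\bar v}=F_M(\bar v)-\mu(I_h\bar v-I_hu)$, $\bar v(0)=v_0$. $T_\ast\ge0,R_\ast>0$ are constants with $\|u(t)\|_V\le R_\ast$ and $\|\bar v(t)\|_V\le R_\ast$ for all $t\ge T_\ast$. Noise: $I_h=R_h\circ O_h$ with linear maps $O_h:\mathbb R^d\to\mathbb R^k$, $R_h:\mathbb R^k\to\mathbb R^d$; $W$ is a standard $k$-dimensional Brownian motion on a filtered probability space; $\Sigma\in\mathbb R^{k\times k}$ is deterministic; $\Gamma_h:=R_h\Sigma\in\mathbb R^{d\times k}$. The SDE is in the Itô sense. *)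

theory Defs
  imports "HOL-Probability.Probability"
begin

section \<open>Structural assumptions on the dynamics\<close>

definition sym_pos_def :: "real ^ 'd ^ 'd \<Rightarrow> bool" where
  "sym_pos_def A \<longleftrightarrow> transpose A = A \<and> (\<forall>z. z \<noteq> 0 \<longrightarrow> 0 < z \<bullet> (A *v z))"

definition is_eigenvalue :: "real ^ 'd ^ 'd \<Rightarrow> real \<Rightarrow> bool" where
  "is_eigenvalue A c \<longleftrightarrow> (\<exists>z. z \<noteq> 0 \<and> A *v z = c *\<^sub>R z)"

definition is_smallest_eigenvalue :: "real ^ 'd ^ 'd \<Rightarrow> real \<Rightarrow> bool" where
  "is_smallest_eigenvalue A c \<longleftrightarrow> is_eigenvalue A c \<and> (\<forall>c'. is_eigenvalue A c' \<longrightarrow> c \<le> c')"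

definition linear_dissipation :: "real ^ 'd ^ 'd \<Rightarrow> real \<Rightarrow> bool" where
  "linear_dissipation A lam \<longleftrightarrow> sym_pos_def A \<and> 0 < lam \<and> is_smallest_eigenvalue A lam"

definition V_norm :: "real ^ 'd ^ 'd \<Rightarrow> real ^ 'd \<Rightarrow> real" where
  "V_norm A z = sqrt (z \<bullet> (A *v z))"

definition H_dissipative ::
  "real \<Rightarrow> real ^ 'd ^ 'd \<Rightarrow> (real ^ 'd \<Rightarrow> real ^ 'd) \<Rightarrow> bool" where
  "H_dissipative \<nu> A N \<longleftrightarrow>
    (\<exists>\<alpha> \<beta>. 0 < \<alpha> \<and> 0 \<le> \<beta> \<and>
      (\<forall>z. \<alpha> * (norm z)\<^sup>2 - \<beta> \<le> \<nu> * (z \<bullet> (A *v z)) + N z \<bullet> z))"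

text \<open>
  The time argument of the library's \<open>local_lipschitz\<close> is a dummy here.
\<close>
definition locally_lipschitz_on ::
  "(real ^ 'd) set \<Rightarrow> (real ^ 'd \<Rightarrow> real ^ 'd) \<Rightarrow> bool" where
  "locally_lipschitz_on G f \<longleftrightarrow> local_lipschitz (UNIV :: real set) G (\<lambda>_. f)"

definition nonlinearity_assumption :: "(real ^ 'd \<Rightarrow> real ^ 'd) \<Rightarrow> bool" where
  "nonlinearity_assumption N \<longleftrightarrow>
    locally_lipschitz_on UNIV N \<and>
    (\<exists>C\<^sub>E\<ge>0. \<forall>z. - C\<^sub>E * (norm z)\<^sup>2 \<le> N z \<bullet> z) \<and>
    (\<forall>R>0. \<exists>C\<^sub>R\<ge>0. \<forall>z z'. norm z \<le> R \<longrightarrow> norm z' \<le> R \<longrightarrow>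
      - ((N z' - N z) \<bullet> (z' - z)) \<le> C\<^sub>R * (norm (z' - z))\<^sup>2)"

definition feedback_operator ::
  "real ^ 'd ^ 'd \<Rightarrow> real \<Rightarrow> real \<Rightarrow> (real \<Rightarrow> real ^ 'd \<Rightarrow> real ^ 'd) \<Rightarrow> bool" where
  "feedback_operator A c\<^sub>0 C\<^sub>I I \<longleftrightarrow>
    0 < c\<^sub>0 \<and> 0 < C\<^sub>I \<and>
    (\<forall>h\<in>{0..1}. linear (I h) \<and>
      (\<forall>z. norm (z - I h z) \<le> c\<^sub>0 * h * V_norm A z) \<and>
      (\<forall>z. norm (I h z) \<le> C\<^sub>I * norm z))"

definition drift ::
  "real \<Rightarrow> real ^ 'd \<Rightarrow> real ^ 'd ^ 'd \<Rightarrow> (real ^ 'd \<Rightarrow> real ^ 'd) \<Rightarrow> real ^ 'd \<Rightarrow> real ^ 'd" where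
  "drift \<nu> f A N z = f - \<nu> *\<^sub>R (A *v z) - N z"


section \<open>The cutoff-extended surrogate\<close>

text \<open>
  Membership in \<open>C\<^sup>\<infinity>([0,\<infinity>))\<close>, with one-sided derivatives at the origin:
  \<open>D n\<close> is the \<open>n\<close>-th derivative.
\<close>
definition smooth_on_halfline :: "(real \<Rightarrow> real) \<Rightarrow> bool" where
  "smooth_on_halfline \<psi> \<longleftrightarrow>
    (\<exists>D :: nat \<Rightarrow> real \<Rightarrow> real. (\<forall>r\<ge>0. D 0 r = \<psi> r) \<and>
      (\<forall>n. \<forall>r\<ge>0. (D n has_real_derivative D (Suc n) r) (at r within {0..})))"

definition cutoff_profile :: "real \<Rightarrow> real \<Rightarrow> (real \<Rightarrow> real) \<Rightarrow> bool" where
  "cutoff_profile R R' \<psi> \<longleftrightarrow>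
    smooth_on_halfline \<psi> \<and> (\<forall>r\<ge>0. 0 \<le> \<psi> r \<and> \<psi> r \<le> 1) \<and>
    (\<forall>r. 0 \<le> r \<and> r \<le> R\<^sup>2 \<longrightarrow> \<psi> r = 1) \<and> (\<forall>r\<ge>R'\<^sup>2. \<psi> r = 0)"

text \<open>
  \<open>Fhat\<close> is a total function here; its values off the neighbourhood on which it is meaningful do
  not matter, because there the cutoff vanishes and so does the first summand.
\<close>
definition cutoff_surrogate ::
  "real ^ 'd ^ 'd \<Rightarrow> (real \<Rightarrow> real) \<Rightarrow> real ^ 'd \<Rightarrow> real ^ 'd ^ 'd \<Rightarrow>
   (real ^ 'd \<Rightarrow> real ^ 'd) \<Rightarrow> real ^ 'd \<Rightarrow> real ^ 'd" where
  "cutoff_surrogate A \<psi> f B Fhat z =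
    (let c = \<psi> ((V_norm A z)\<^sup>2) in c *\<^sub>R Fhat z + (1 - c) *\<^sub>R (f - B *v z))"


section \<open>Deterministic and stochastic differential equations\<close>

definition nudged_drift ::
  "(real ^ 'd \<Rightarrow> real ^ 'd) \<Rightarrow> real \<Rightarrow> (real ^ 'd \<Rightarrow> real ^ 'd) \<Rightarrow> (real \<Rightarrow> real ^ 'd) \<Rightarrow>
   real \<Rightarrow> real ^ 'd \<Rightarrow> real ^ 'd" where
  "nudged_drift F \<mu> I u t z = F z - \<mu> *\<^sub>R (I z - I (u t))"

definition global_ode_solution ::
  "(real \<Rightarrow> real ^ 'd \<Rightarrow> real ^ 'd) \<Rightarrow> real ^ 'd \<Rightarrow> (real \<Rightarrow> real ^ 'd) \<Rightarrow> bool" where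
  "global_ode_solution b x\<^sub>0 x \<longleftrightarrow>
    x 0 = x\<^sub>0 \<and> (\<forall>t\<ge>0. (x has_vector_derivative b t (x t)) (at t within {0..}))"

text \<open>
  Processes and filtrations are indexed by \<^typ>\<open>real\<close>, and only indices \<open>t \<ge> 0\<close> are meaningful.
  The library locale \<^locale>\<open>filtration\<close> would also constrain negative indices.
\<close>
definition filtered_prob_space :: "'w measure \<Rightarrow> (real \<Rightarrow> 'w measure) \<Rightarrow> bool" where
  "filtered_prob_space M Fl \<longleftrightarrow>
    prob_space M \<and> (\<forall>t\<ge>0. subalgebra M (Fl t)) \<and>
    (\<forall>s t. 0 \<le> s \<and> s \<le> t \<longrightarrow> sets (Fl s) \<subseteq> sets (Fl t))"

definition adapted_process ::
  "(real \<Rightarrow> 'w measure) \<Rightarrow> (real \<Rightarrow> 'w \<Rightarrow> real ^ 'n) \<Rightarrow> bool" where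
  "adapted_process Fl X \<longleftrightarrow> (\<forall>t\<ge>0. X t \<in> borel_measurable (Fl t))"

text \<open>
  For \<open>s < t\<close> the increment is independent of \<open>Fl s\<close> and has law \<open>N(0, (t - s) Id)\<close>; the density
  is the product of the one-dimensional normal densities.
\<close>
definition standard_brownian_motion ::
  "'w measure \<Rightarrow> (real \<Rightarrow> 'w measure) \<Rightarrow> (real \<Rightarrow> 'w \<Rightarrow> real ^ 'k) \<Rightarrow> bool" where
  "standard_brownian_motion M Fl W \<longleftrightarrow>
    adapted_process Fl W \<and>
    (AE \<omega> in M. W 0 \<omega> = 0) \<and>
    (AE \<omega> in M. continuous_on {0..} (\<lambda>t. W t \<omega>)) \<and>
    (\<forall>s t. 0 \<le> s \<and> s < t \<longrightarrow>
      distributed M lborel (\<lambda>\<omega>. W t \<omega> - W s \<omega>)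
        (\<lambda>x. \<Prod>i\<in>UNIV. ennreal (normal_density 0 (sqrt (t - s)) (x $ i))) \<and>
      prob_space.indep_set M (sets (Fl s))
        {(\<lambda>\<omega>. W t \<omega> - W s \<omega>) -` S \<inter> space M |S. S \<in> sets borel})"

text \<open>
  A global adapted strong solution of the Ito equation \<open>dv = b(t, v) dt + G dW\<close>, \<open>v(0) = x\<^sub>0\<close>, with
  a constant deterministic diffusion matrix \<open>G\<close>. The Ito integral of the elementary integrand
  \<open>G\<close> over \<open>[0, t]\<close> is by definition \<open>G (W\<^sub>t - W\<^sub>0)\<close>.
\<close>
definition strong_solution_additive ::
  "'w measure \<Rightarrow> (real \<Rightarrow> 'w measure) \<Rightarrow> (real \<Rightarrow> 'w \<Rightarrow> real ^ 'k) \<Rightarrow>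
   (real \<Rightarrow> real ^ 'd \<Rightarrow> real ^ 'd) \<Rightarrow> real ^ 'k ^ 'd \<Rightarrow> real ^ 'd \<Rightarrow>
   (real \<Rightarrow> 'w \<Rightarrow> real ^ 'd) \<Rightarrow> bool" where
  "strong_solution_additive M Fl W b G x\<^sub>0 v \<longleftrightarrow>
    adapted_process Fl v \<and>
    (AE \<omega> in M. continuous_on {0..} (\<lambda>t. v t \<omega>)) \<and>
    (AE \<omega> in M. \<forall>t\<ge>0.
      (\<lambda>s. b s (v s \<omega>)) absolutely_integrable_on {0..t} \<and>
      v t \<omega> = x\<^sub>0 + integral {0..t} (\<lambda>s. b s (v s \<omega>)) + G *v (W t \<omega> - W 0 \<omega>))"

end

theory Submission
  imports Defs
begin

text \<open>
  Put \<open>w = v - u\<close>, so that \<open>dw = g dt + \<mu> \<Gamma> dW\<close> with \<open>g = F\<^sub>M(v) - F(u) - \<mu> I\<^sub>h w\<close>. Since the noise is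
  additive, Ito's formula for the squared norm can be replaced by ordinary calculus along each path:
  with \<open>S\<^sub>r = \<mu> \<Gamma> (W\<^sub>r - W\<^sub>s)\<close> the difference \<open>w - S\<close> is continuously differentiable on \<open>[s, t]\<close>, whence
  \<open>|w\<^sub>t|\<^sup>2 = |w\<^sub>s|\<^sup>2 + 2 \<integral> \<langle>w\<^sub>r, g\<^sub>r\<rangle> dr + 2 \<integral> \<langle>g\<^sub>r, S\<^sub>t - S\<^sub>r\<rangle> dr + 2 \<langle>w\<^sub>s, S\<^sub>t\<rangle> + |S\<^sub>t|\<^sup>2\<close>.
  By Fubini and independence of increments the two middle cross terms have mean zero, and \<open>|S\<^sub>t|\<^sup>2\<close> has
  mean \<open>(t - s) \<mu>\<^sup>2 Tr(\<Gamma> \<Gamma>\<^sup>T)\<close>. The second moments needed for this are finite because the cutoff drift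
  grows at most linearly. Squeezing, the feedback approximation property and coercivity of \<open>A\<close> bound
  \<open>2 \<langle>w, g\<rangle>\<close> by \<open>\<delta>\<^sub>M\<^sup>2 / (\<lambda>\<^sub>1 \<nu>\<^sub>e\<^sub>f\<^sub>f) - \<gamma> |w|\<^sup>2\<close>, and a Gronwall argument finishes the proof.
\<close>

section \<open>Moments of Gaussian vectors\<close>

text \<open>By \<open>lborel_eq\<close>, Lebesgue measure on a Euclidean space is the image of a
  product of one-dimensional Lebesgue measures under the map that sends coordinates to the vector
  they determine. Fubini for finite products therefore transfers to functions that factor over the
  basis.\<close>

lemma
  fixes f :: "'a::euclidean_space \<Rightarrow> real \<Rightarrow> real"
  assumes f: "\<And>b. b \<in> Basis \<Longrightarrow> integrable lborel (f b)"
  shows integrable_lborel_prod: "integrable lborel (\<lambda>x::'a. \<Prod>b\<in>Basis. f b (x \<bullet> b))"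
    and integral_lborel_prod:
      "(\<integral>x. (\<Prod>b\<in>Basis. f b (x \<bullet> b)) \<partial>(lborel :: 'a measure)) = (\<Prod>b\<in>Basis. \<integral>x. f b x \<partial>lborel)"
proof -
  interpret P: product_sigma_finite "\<lambda>_::'a. lborel :: real measure" ..
  have [measurable]: "f b \<in> borel_measurable borel" if "b \<in> Basis" for b
    using f[OF that] by simp
  have T: "(\<lambda>g. \<Sum>b\<in>Basis. g b *\<^sub>R b :: 'a) \<in> (\<Pi>\<^sub>M b\<in>Basis. (lborel::real measure)) \<rightarrow>\<^sub>M borel"
    by measurable
  have m: "(\<lambda>x::'a. \<Prod>b\<in>Basis. f b (x \<bullet> b)) \<in> borel_measurable borel"
    by measurable
  have eq: "(\<Prod>b\<in>Basis. f b ((\<Sum>b'\<in>Basis. g b' *\<^sub>R b') \<bullet> b)) = (\<Prod>b\<in>Basis. f b (g b))" for g :: "'a \<Rightarrow> real"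
    by (intro prod.cong refl) simp
  show "integrable lborel (\<lambda>x::'a. \<Prod>b\<in>Basis. f b (x \<bullet> b))"
    using P.product_integrable_prod[OF finite_Basis f]
    by (subst lborel_eq, subst integrable_distr_eq[OF T m]) (simp add: eq)
  show "(\<integral>x. (\<Prod>b\<in>Basis. f b (x \<bullet> b)) \<partial>(lborel :: 'a measure)) = (\<Prod>b\<in>Basis. \<integral>x. f b x \<partial>lborel)"
    using P.product_integral_prod[OF finite_Basis f]
    by (subst lborel_eq, subst integral_distr[OF T m]) (simp add: eq)
qed

lemma prod_Basis_vec:
  "(\<Prod>b\<in>(Basis :: (real ^ 'n) set). F b) = (\<Prod>i\<in>UNIV. F (axis i 1))"
proof -
  have "(Basis :: (real ^ 'n) set) = (\<lambda>i. axis i 1) ` UNIV"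
    by (auto simp: Basis_vec_def)
  moreover have "inj (\<lambda>i::'n. axis i (1::real))"
    by (auto simp: inj_on_def axis_eq_axis)
  ultimately show ?thesis
    using prod.reindex[of "\<lambda>i::'n. axis i (1::real)" UNIV F] by simp
qed

lemma
  fixes f :: "'n::finite \<Rightarrow> real \<Rightarrow> real"
  assumes f: "\<And>i. integrable lborel (f i)"
  shows integrable_lborel_prod_vec: "integrable lborel (\<lambda>x :: real ^ 'n. \<Prod>i\<in>UNIV. f i (x $ i))"
    and integral_lborel_prod_vec:
      "(\<integral>x. (\<Prod>i\<in>UNIV. f i (x $ i)) \<partial>(lborel :: (real ^ 'n) measure)) = (\<Prod>i\<in>UNIV. \<integral>x. f i x \<partial>lborel)"
proof -
  \<comment> \<open>The factors above are indexed by basis vectors, here by coordinates.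
    \<open>g\<close> translates one indexing into the other; at every argument it is one of the
    \<open>f i\<close>, so it is integrable everywhere.\<close>
  define g where "g b = f (THE i. b = axis i 1)" for b :: "real ^ 'n"
  have g: "g (axis i 1) = f i" for i
    unfolding g_def by (simp add: axis_eq_axis)
  have gi: "integrable lborel (g b)" for b
    unfolding g_def using f .
  from integrable_lborel_prod[of g] integral_lborel_prod[of g]
  show "integrable lborel (\<lambda>x :: real ^ 'n. \<Prod>i\<in>UNIV. f i (x $ i))"
    and "(\<integral>x. (\<Prod>i\<in>UNIV. f i (x $ i)) \<partial>(lborel :: (real ^ 'n) measure)) = (\<Prod>i\<in>UNIV. \<integral>x. f i x \<partial>lborel)"
    using gi by (simp_all add: prod_Basis_vec g cart_eq_inner_axis)
qed

lemma normal_power_moments: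
  assumes "0 < \<sigma>"
  shows "integrable lborel (\<lambda>x. normal_density 0 \<sigma> x * x ^ k)"
    and "(\<integral>x. normal_density 0 \<sigma> x * x \<partial>lborel) = 0"
    and "(\<integral>x. normal_density 0 \<sigma> x * x\<^sup>2 \<partial>lborel) = \<sigma>\<^sup>2"
  using integrable_normal_moment[OF assms, of 0 k] integral_normal_moment_odd[OF assms, of 0 0]
    integral_normal_moment_even[OF assms, of 0 1]
  by (simp_all add: numeral_eq_Suc)

context prob_space
begin

text \<open>The density and the monomial both factor over the coordinates, so the moment is a
  product of one-dimensional moments. Leaving the exponents free lets means and covariances arise as
  special cases.\<close>

lemma
  fixes X :: "'a \<Rightarrow> real ^ 'k"
  assumes "0 < \<sigma>"
    and X: "distributed M lborel X (\<lambda>x. \<Prod>i\<in>UNIV. ennreal (normal_density 0 \<sigma> (x $ i)))"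
  shows gaussian_vec_integrable_monomial: "integrable M (\<lambda>\<omega>. \<Prod>i\<in>UNIV. (X \<omega> $ i) ^ p i)"
    and gaussian_vec_integral_monomial: "expectation (\<lambda>\<omega>. \<Prod>i\<in>UNIV. (X \<omega> $ i) ^ p i) =
      (\<Prod>i\<in>UNIV. \<integral>x. normal_density 0 \<sigma> x * x ^ p i \<partial>lborel)"
proof -
  let ?d = "\<lambda>x :: real ^ 'k. \<Prod>i\<in>UNIV. normal_density 0 \<sigma> (x $ i)"
  have X': "distributed M lborel X (\<lambda>x. ennreal (?d x))"
    using X by (simp add: prod_ennreal)
  have nn: "0 \<le> ?d x" for x by (simp add: prod_nonneg)
  have eq: "?d x * (\<Prod>i\<in>UNIV. (x $ i) ^ p i) = (\<Prod>i\<in>UNIV. normal_density 0 \<sigma> (x $ i) * (x $ i) ^ p i)" for x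
    by (simp add: prod.distrib)
  note int = normal_power_moments(1)[OF \<open>0 < \<sigma>\<close>]
  show "integrable M (\<lambda>\<omega>. \<Prod>i\<in>UNIV. (X \<omega> $ i) ^ p i)"
    using integrable_lborel_prod_vec[of "\<lambda>i x. normal_density 0 \<sigma> x * x ^ p i"] int
    by (subst distributed_integrable[OF X', symmetric]) (simp_all add: nn eq)
  show "expectation (\<lambda>\<omega>. \<Prod>i\<in>UNIV. (X \<omega> $ i) ^ p i) =
      (\<Prod>i\<in>UNIV. \<integral>x. normal_density 0 \<sigma> x * x ^ p i \<partial>lborel)"
    using integral_lborel_prod_vec[of "\<lambda>i x. normal_density 0 \<sigma> x * x ^ p i"] int
    by (subst distributed_integral[OF X', symmetric]) (simp_all add: nn eq)
qed

lemma
  fixes X :: "'a \<Rightarrow> real ^ 'k"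
  assumes \<sigma>: "0 < \<sigma>"
    and X: "distributed M lborel X (\<lambda>x. \<Prod>i\<in>UNIV. ennreal (normal_density 0 \<sigma> (x $ i)))"
  shows gaussian_vec_integrable_component: "integrable M (\<lambda>\<omega>. X \<omega> $ j)"
    and gaussian_vec_mean: "expectation (\<lambda>\<omega>. X \<omega> $ j) = 0"
    and gaussian_vec_integrable_mult: "integrable M (\<lambda>\<omega>. X \<omega> $ j * X \<omega> $ l)"
    and gaussian_vec_covariance: "expectation (\<lambda>\<omega>. X \<omega> $ j * X \<omega> $ l) = (if j = l then \<sigma>\<^sup>2 else 0)"
proof -
  note mono = gaussian_vec_integrable_monomial[OF assms] gaussian_vec_integral_monomial[OF assms]
  \<comment> \<open>Exponents of the form \<open>of_bool (i = j)\<close> make the monomial pick out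
    single coordinates. Adding two of them gives a product of coordinates, which is a square when
    \<open>j = l\<close>.\<close>
  have pow: "x ^ of_bool b = (if b then x else 1)" for x :: real and b
    by simp
  have p1: "(\<Prod>i\<in>UNIV. (x $ i) ^ of_bool (i = j)) = x $ j" for x :: "real ^ 'k" and j
    by (simp add: pow)
  have p2: "(\<Prod>i\<in>UNIV. (x $ i) ^ (of_bool (i = j) + of_bool (i = l))) = x $ j * x $ l" for x :: "real ^ 'k"
    by (simp add: power_add prod.distrib p1)
  show "integrable M (\<lambda>\<omega>. X \<omega> $ j)"
    using mono(1)[of "\<lambda>i. of_bool (i = j)"] unfolding p1 .
  show "integrable M (\<lambda>\<omega>. X \<omega> $ j * X \<omega> $ l)"
    using mono(1)[of "\<lambda>i. of_bool (i = j) + of_bool (i = l)"] unfolding p2 .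
  \<comment> \<open>An exponent 1 contributes the vanishing first moment as a factor. This settles
    both the mean and the off-diagonal covariances.\<close>
  have z: "(\<Prod>i\<in>UNIV. \<integral>x. normal_density 0 \<sigma> x * x ^ p i \<partial>lborel) = 0" if "p m = 1" for p :: "'k \<Rightarrow> nat" and m
    using that normal_power_moments(2)[OF \<sigma>] by (intro prod_zero) (auto intro!: exI[of _ m])
  show "expectation (\<lambda>\<omega>. X \<omega> $ j) = 0"
    using mono(2)[of "\<lambda>i. of_bool (i = j)"] z[of "\<lambda>i. of_bool (i = j)" j] unfolding p1 by simp
  show "expectation (\<lambda>\<omega>. X \<omega> $ j * X \<omega> $ l) = (if j = l then \<sigma>\<^sup>2 else 0)"
  proof (cases "j = l")
    case True
    have "(\<integral>x. normal_density 0 \<sigma> x * x ^ (of_bool (i = j) + of_bool (i = l)) \<partial>lborel) = (if i = j then \<sigma>\<^sup>2 else 1)" for i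
      using True normal_power_moments(3)[OF \<sigma>] integral_normal_density[OF \<sigma>] by (simp add: numeral_2_eq_2)
    then show ?thesis
      using mono(2)[of "\<lambda>i. of_bool (i = j) + of_bool (i = l)"] True unfolding p2
      by (simp add: prod.delta)
  next
    case False
    then show ?thesis
      using mono(2)[of "\<lambda>i. of_bool (i = j) + of_bool (i = l)"]
        z[of "\<lambda>i. of_bool (i = j) + of_bool (i = l)" j] unfolding p2 by simp
  qed
qed

end

section \<open>Brownian increments\<close>

context prob_space
begin

text \<open>Independence passes to smaller families: the events generated by \<open>X\<close> lie in
  \<open>N\<close>, and those generated by \<open>g\<close> applied to \<open>Y\<close> are
  preimages under \<open>Y\<close>. The function \<open>g\<close> makes it possible to extract one
  coordinate of a vector increment, since the product rule for expectations is applied to scalar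
  variables.\<close>

lemma indep_set_imp_indep_var:
  fixes X :: "'a \<Rightarrow> 'b::topological_space" and g :: "'c::topological_space \<Rightarrow> 'b"
  assumes sub: "subalgebra M N"
    and X: "X \<in> borel_measurable N" and Y: "Y \<in> borel_measurable M" and g: "g \<in> borel_measurable borel"
    and indep: "indep_set (sets N) {Y -` S \<inter> space M |S. S \<in> sets borel}"
  shows "indep_var borel X borel (\<lambda>\<omega>. g (Y \<omega>))"
proof -
  have sp: "space N = space M" using sub by (simp add: subalgebra_def)
  have gY: "(\<lambda>\<omega>. g (Y \<omega>)) \<in> borel_measurable M"
    using Y g by measurable
  have "{X -` A \<inter> space M |A. A \<in> sets borel} \<subseteq> sets N"
    using measurable_sets[OF X] sp by auto
  then have 1: "sigma_sets (space M) {X -` A \<inter> space M |A. A \<in> sets borel} \<subseteq> sets N"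
    using sets.sigma_sets_subset[of _ N] sp by simp
  have "{(\<lambda>\<omega>. g (Y \<omega>)) -` A \<inter> space M |A. A \<in> sets borel} \<subseteq> sets (vimage_algebra (space M) Y borel)"
  proof safe
    fix A :: "'b set" assume "A \<in> sets borel"
    then have "g -` A \<in> sets borel" using measurable_sets[OF g] by simp
    then have "Y -` (g -` A) \<inter> space M \<in> sets (vimage_algebra (space M) Y borel)"
      by (intro in_vimage_algebra)
    moreover have "(\<lambda>\<omega>. g (Y \<omega>)) -` A \<inter> space M = Y -` (g -` A) \<inter> space M" by auto
    ultimately show "(\<lambda>\<omega>. g (Y \<omega>)) -` A \<inter> space M \<in> sets (vimage_algebra (space M) Y borel)" by simp
  qed
  then have "sigma_sets (space M) {(\<lambda>\<omega>. g (Y \<omega>)) -` A \<inter> space M |A. A \<in> sets borel}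
      \<subseteq> sets (vimage_algebra (space M) Y borel)"
    using sets.sigma_sets_subset[of _ "vimage_algebra (space M) Y borel"] by simp
  also have "\<dots> = {Y -` S \<inter> space M |S. S \<in> sets borel}"
    by (subst sets_vimage_algebra2) auto
  finally have 2: "sigma_sets (space M) {(\<lambda>\<omega>. g (Y \<omega>)) -` A \<inter> space M |A. A \<in> sets borel}
      \<subseteq> {Y -` S \<inter> space M |S. S \<in> sets borel}" .
  have "X \<in> borel_measurable M"
    using X sub by (rule measurable_from_subalg[rotated])
  moreover have "indep_set (sigma_sets (space M) {X -` A \<inter> space M |A. A \<in> sets borel})
     (sigma_sets (space M) {(\<lambda>\<omega>. g (Y \<omega>)) -` A \<inter> space M |A. A \<in> sets borel})"
    using indep unfolding indep_set_def
    by (rule indep_sets_mono_sets) (use 1 2 in \<open>simp split: bool.split\<close>)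
  ultimately show ?thesis
    using gY by (simp add: indep_var_eq)
qed

lemma measurable_vec_component:
  fixes X :: "'b \<Rightarrow> real ^ 'n"
  shows "X \<in> borel_measurable N \<Longrightarrow> (\<lambda>\<omega>. X \<omega> $ i) \<in> borel_measurable N"
  by (rule measurable_compose[OF _ borel_measurable_continuous_onI])
    (auto intro!: continuous_intros)

lemma integrable_inner_of_square:
  fixes X Y :: "'a \<Rightarrow> 'b::euclidean_space"
  assumes [measurable]: "X \<in> borel_measurable M" "Y \<in> borel_measurable M"
    and "integrable M (\<lambda>\<omega>. (norm (X \<omega>))\<^sup>2)" "integrable M (\<lambda>\<omega>. (norm (Y \<omega>))\<^sup>2)"
  shows "integrable M (\<lambda>\<omega>. X \<omega> \<bullet> Y \<omega>)"
proof (rule Bochner_Integration.integrable_bound)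
  show "integrable M (\<lambda>\<omega>. (norm (X \<omega>))\<^sup>2 + (norm (Y \<omega>))\<^sup>2)"
    using assms by simp
  show "AE \<omega> in M. norm (X \<omega> \<bullet> Y \<omega>) \<le> norm ((norm (X \<omega>))\<^sup>2 + (norm (Y \<omega>))\<^sup>2)"
  proof (rule AE_I2)
    fix \<omega>
    have "\<bar>X \<omega> \<bullet> Y \<omega>\<bar> \<le> norm (X \<omega>) * norm (Y \<omega>)"
      by (rule Cauchy_Schwarz_ineq2)
    also have "\<dots> \<le> (norm (X \<omega>))\<^sup>2 + (norm (Y \<omega>))\<^sup>2"
      using sum_squares_bound[of "norm (X \<omega>)" "norm (Y \<omega>)"]
        zero_le_power2[of "norm (X \<omega>)"] zero_le_power2[of "norm (Y \<omega>)"] by linarith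
    finally show "norm (X \<omega> \<bullet> Y \<omega>) \<le> norm ((norm (X \<omega>))\<^sup>2 + (norm (Y \<omega>))\<^sup>2)"
      by simp
  qed
qed simp

end

lemma trace_mult_transpose:
  fixes G :: "real ^ 'k ^ 'd"
  shows "trace (G ** transpose G) = (\<Sum>i\<in>UNIV. \<Sum>j\<in>UNIV. (G $ i $ j)\<^sup>2)"
  by (simp add: trace_def matrix_matrix_mult_def transpose_def power2_eq_square)

locale brownian = prob_space M for M :: "'w measure" +
  fixes Fl :: "real \<Rightarrow> 'w measure" and W :: "real \<Rightarrow> 'w \<Rightarrow> real ^ 'k"
  assumes filtered: "filtered_prob_space M Fl"
    and BM: "standard_brownian_motion M Fl W"
begin

lemma subalg: "0 \<le> t \<Longrightarrow> subalgebra M (Fl t)"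
  using filtered by (simp add: filtered_prob_space_def)

lemma adapted_measurable: "X \<in> borel_measurable (Fl t) \<Longrightarrow> 0 \<le> t \<Longrightarrow> X \<in> borel_measurable M"
  using measurable_from_subalg[OF subalg] by blast

lemma W_measurable: "0 \<le> t \<Longrightarrow> W t \<in> borel_measurable M"
  using BM by (auto simp: standard_brownian_motion_def adapted_process_def intro: adapted_measurable)

lemma increment_measurable: "0 \<le> s \<Longrightarrow> 0 \<le> t \<Longrightarrow> (\<lambda>\<omega>. W t \<omega> - W s \<omega>) \<in> borel_measurable M"
  using W_measurable by measurable

lemma
  assumes "0 \<le> s" "s < t"
  shows increment_distributed: "distributed M lborel (\<lambda>\<omega>. W t \<omega> - W s \<omega>)
      (\<lambda>x. \<Prod>i\<in>UNIV. ennreal (normal_density 0 (sqrt (t - s)) (x $ i)))"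
    and increment_indep: "indep_set (sets (Fl s))
      {(\<lambda>\<omega>. W t \<omega> - W s \<omega>) -` S \<inter> space M |S. S \<in> sets borel}"
  using BM assms unfolding standard_brownian_motion_def by blast+

text \<open>The Ito isometry for a constant integrand: the increment has covariance (t - s) times
  the identity, so only the squared entries of \<open>G\<close> survive the expectation, and these
  add up to the trace.\<close>

lemma
  assumes st: "0 \<le> s" "s \<le> t"
  shows increment_square_integrable: "integrable M (\<lambda>\<omega>. (norm (G *v (W t \<omega> - W s \<omega>)))\<^sup>2)"
    and increment_square_expectation:
      "expectation (\<lambda>\<omega>. (norm (G *v (W t \<omega> - W s \<omega>)))\<^sup>2) = (t - s) * trace (G ** transpose G)"
proof -
  have "integrable M (\<lambda>\<omega>. (norm (G *v (W t \<omega> - W s \<omega>)))\<^sup>2) \<and>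
      expectation (\<lambda>\<omega>. (norm (G *v (W t \<omega> - W s \<omega>)))\<^sup>2) = (t - s) * trace (G ** transpose G)"
  proof (cases "s = t")
    \<comment> \<open>The law of an increment is prescribed only for \<open>s < t\<close>. For
      \<open>s = t\<close> the increment is zero and both claims are immediate.\<close>
    case False
    with st have lt: "s < t" and \<sigma>: "0 < sqrt (t - s)" by auto
    note D = increment_distributed[OF st(1) lt]
    define X where "X \<omega> = W t \<omega> - W s \<omega>" for \<omega>
    note cov = gaussian_vec_integrable_mult[OF \<sigma> D, folded X_def] gaussian_vec_covariance[OF \<sigma> D, folded X_def]
    have eq: "(norm (G *v X \<omega>))\<^sup>2 =
        (\<Sum>i\<in>UNIV. \<Sum>j\<in>UNIV. \<Sum>l\<in>UNIV. (G $ i $ j * G $ i $ l) * (X \<omega> $ j * X \<omega> $ l))" for \<omega>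
      unfolding power2_norm_eq_inner inner_vec_def matrix_vector_mult_def
      by (simp add: sum_product algebra_simps)
    have "expectation (\<lambda>\<omega>. (norm (G *v X \<omega>))\<^sup>2) =
        (\<Sum>i\<in>UNIV. \<Sum>j\<in>UNIV. \<Sum>l\<in>UNIV. (G $ i $ j * G $ i $ l) * (if j = l then (sqrt (t - s))\<^sup>2 else 0))"
      unfolding eq using cov by simp
    also have "\<dots> = (t - s) * trace (G ** transpose G)"
      using lt by (simp add: trace_mult_transpose if_distrib sum_distrib_left power2_eq_square algebra_simps
        cong: if_cong)
    finally show ?thesis
      using cov by (auto simp: eq X_def[symmetric])
  qed simp
  then show "integrable M (\<lambda>\<omega>. (norm (G *v (W t \<omega> - W s \<omega>)))\<^sup>2)"
    and "expectation (\<lambda>\<omega>. (norm (G *v (W t \<omega> - W s \<omega>)))\<^sup>2) = (t - s) * trace (G ** transpose G)"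
    by auto
qed

text \<open>\<open>X\<close> belongs to the past of \<open>s\<close>, while the increment after
  \<open>s\<close> is independent of that past and centred. In coordinates each summand is a product
  of independent variables, one of mean zero. This takes the place of the martingale property of a
  stochastic integral.\<close>

lemma increment_orthogonal:
  fixes X :: "'w \<Rightarrow> real ^ 'd" and G :: "real ^ 'k ^ 'd"
  assumes st: "0 \<le> s" "s \<le> t"
    and X: "X \<in> borel_measurable (Fl s)" and X2: "integrable M (\<lambda>\<omega>. (norm (X \<omega>))\<^sup>2)"
  shows "expectation (\<lambda>\<omega>. X \<omega> \<bullet> (G *v (W t \<omega> - W s \<omega>))) = 0"
proof (cases "s = t")
  case False
  with st have lt: "s < t" and \<sigma>: "0 < sqrt (t - s)" by auto
  note D = increment_distributed[OF st(1) lt]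
  define Y where "Y \<omega> = W t \<omega> - W s \<omega>" for \<omega>
  have XM: "X \<in> borel_measurable M" using X st by (intro adapted_measurable)
  have Xi: "integrable M (\<lambda>\<omega>. X \<omega> $ i)" for i
  proof (rule square_integrable_imp_integrable)
    show meas: "(\<lambda>\<omega>. X \<omega> $ i) \<in> borel_measurable M" using XM by (rule measurable_vec_component)
    show "integrable M (\<lambda>\<omega>. (X \<omega> $ i)\<^sup>2)"
    proof (rule Bochner_Integration.integrable_bound[OF X2])
      show "(\<lambda>\<omega>. (X \<omega> $ i)\<^sup>2) \<in> borel_measurable M" using meas by measurable
      show "AE \<omega> in M. norm ((X \<omega> $ i)\<^sup>2) \<le> norm ((norm (X \<omega>))\<^sup>2)"
        using component_le_norm_cart[of _ i] by (auto simp: abs_le_square_iff[symmetric])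
    qed
  qed
  have Yj: "integrable M (\<lambda>\<omega>. Y \<omega> $ j)" "expectation (\<lambda>\<omega>. Y \<omega> $ j) = 0" for j
    using gaussian_vec_integrable_component[OF \<sigma> D] gaussian_vec_mean[OF \<sigma> D] by (simp_all add: Y_def)
  have ind: "indep_var borel (\<lambda>\<omega>. X \<omega> $ i) borel (\<lambda>\<omega>. Y \<omega> $ j)" for i j
    unfolding Y_def
    by (rule indep_set_imp_indep_var[OF subalg[OF st(1)], where g = "\<lambda>y. y $ j"])
      (use X increment_measurable increment_indep[OF st(1) lt] st in
        \<open>auto intro: measurable_vec_component\<close>)
  note XY = indep_var_integrable[OF ind Xi Yj(1)] indep_var_lebesgue_integral[OF ind Xi Yj(1)]
  have eq: "X \<omega> \<bullet> (G *v Y \<omega>) = (\<Sum>i\<in>UNIV. \<Sum>j\<in>UNIV. G $ i $ j * (X \<omega> $ i * Y \<omega> $ j))" for \<omega>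
    unfolding inner_vec_def matrix_vector_mult_def by (simp add: sum_distrib_left algebra_simps)
  have "expectation (\<lambda>\<omega>. X \<omega> \<bullet> (G *v Y \<omega>)) = 0"
    unfolding eq using XY Yj by simp
  then show ?thesis by (simp add: Y_def)
qed simp

end

section \<open>Fubini for processes with continuous paths\<close>

text \<open>Joint measurability comes from approximation by step processes: rounding the time down
  to a grid leaves countably many time values, so each approximant is measurable, and continuity of
  the paths gives pointwise convergence. Clamping the time to \<open>{a..b}\<close> makes the
  process meaningful on the whole line.\<close>

lemma measurable_continuous_paths:
  fixes H :: "real \<Rightarrow> 'w \<Rightarrow> real"
  assumes ab: "a \<le> b"
    and meas: "\<And>r. r \<in> {a..b} \<Longrightarrow> H r \<in> borel_measurable M"
    and cont: "\<And>\<omega>. continuous_on {a..b} (\<lambda>r. H r \<omega>)"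
  shows "(\<lambda>(r, \<omega>). H (max a (min b r)) \<omega>) \<in> borel_measurable (lborel \<Otimes>\<^sub>M M)"
proof -
  \<comment> \<open>The grid at stage \<open>n\<close> has mesh \<open>1 / Suc n\<close>.
    \<open>q n k\<close> is its clamped \<open>k\<close>-th point, and \<open>c n r\<close> below is
    the index of the last grid point not beyond \<open>r\<close>.\<close>
  define q where "q n k = max a (min b (real_of_int k / real (Suc n)))" for n k
  define c where "c n r = \<lfloor>real (Suc n) * r\<rfloor>" for n and r :: real
  have q: "q n k \<in> {a..b}" for n k using ab by (auto simp: q_def)
  have m: "(\<lambda>p. H (q n (c n (fst p))) (snd p)) \<in> borel_measurable (lborel \<Otimes>\<^sub>M M)" for n
  proof (rule measurable_compose_countable)
    show "(\<lambda>p. H (q n k) (snd p)) \<in> borel_measurable (lborel \<Otimes>\<^sub>M M)" for k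
      using meas[OF q] by measurable
    show "(\<lambda>p. c n (fst p)) \<in> (lborel \<Otimes>\<^sub>M M) \<rightarrow>\<^sub>M count_space UNIV"
      unfolding c_def by measurable
  qed
  have lim: "(\<lambda>n. H (q n (c n r)) \<omega>) \<longlonglongrightarrow> H (max a (min b r)) \<omega>" for r \<omega>
  proof -
    have "(\<lambda>n. real_of_int (c n r) / real (Suc n)) \<longlonglongrightarrow> r"
    proof (rule tendsto_sandwich)
      show "(\<lambda>n. r - 1 / real (Suc n)) \<longlonglongrightarrow> r"
        using tendsto_diff[OF tendsto_const LIMSEQ_inverse_real_of_nat, of r] by (simp add: inverse_eq_divide)
      show "\<forall>\<^sub>F n in sequentially. r - 1 / real (Suc n) \<le> real_of_int (c n r) / real (Suc n)"
      proof (rule always_eventually, rule allI)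
        fix n
        have "real (Suc n) * r - 1 \<le> real_of_int (c n r)"
          unfolding c_def by linarith
        then have "(real (Suc n) * r - 1) / real (Suc n) \<le> real_of_int (c n r) / real (Suc n)"
          by (intro divide_right_mono) auto
        then show "r - 1 / real (Suc n) \<le> real_of_int (c n r) / real (Suc n)"
          by (simp add: diff_divide_distrib)
      qed
      show "\<forall>\<^sub>F n in sequentially. real_of_int (c n r) / real (Suc n) \<le> r"
      proof (rule always_eventually, rule allI)
        fix n
        have "real_of_int (c n r) \<le> real (Suc n) * r"
          unfolding c_def by linarith
        then show "real_of_int (c n r) / real (Suc n) \<le> r"
          by (simp add: field_simps)
      qed
    qed simp
    then have "(\<lambda>n. q n (c n r)) \<longlonglongrightarrow> max a (min b r)"
      unfolding q_def by (intro tendsto_intros)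
    moreover have "max a (min b r) \<in> {a..b}" using ab by auto
    ultimately show ?thesis
      using q by (intro continuous_on_tendsto_compose[OF cont]) auto
  qed
  show ?thesis
    by (rule borel_measurable_LIMSEQ_metric[OF m]) (use lim in auto)
qed

text \<open>
  The pathwise integral itself need not be measurable, because \<open>M\<close> need not be complete; \<open>Z\<close> is a
  measurable version of it.
\<close>
lemma (in prob_space) fubini_continuous_paths:
  fixes H :: "real \<Rightarrow> 'a \<Rightarrow> real"
  assumes ab: "a \<le> b"
    and int: "\<And>r. r \<in> {a..b} \<Longrightarrow> integrable M (H r)"
    and cont: "AE \<omega> in M. continuous_on {a..b} (\<lambda>r. H r \<omega>)"
    and bound: "\<And>r. r \<in> {a..b} \<Longrightarrow> expectation (\<lambda>\<omega>. \<bar>H r \<omega>\<bar>) \<le> C"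
  obtains Z where "integrable M Z" "AE \<omega> in M. Z \<omega> = integral {a..b} (\<lambda>r. H r \<omega>)"
    "(\<lambda>r. expectation (H r)) integrable_on {a..b}"
    "expectation Z = integral {a..b} (\<lambda>r. expectation (H r))"
proof -
  obtain N where N: "N \<in> null_sets M" "{\<omega> \<in> space M. \<not> continuous_on {a..b} (\<lambda>r. H r \<omega>)} \<subseteq> N"
    using cont by (auto simp: eventually_ae_filter)
  have N' [measurable]: "space M - N \<in> sets M" using N(1) by auto
  \<comment> \<open>\<open>K\<close> replaces the paths over the null set \<open>N\<close> by zero.
    All its paths are then continuous, as joint measurability requires, while every expectation
    stays the same.\<close>
  define K where "K r \<omega> = (if \<omega> \<in> space M - N then H r \<omega> else 0)" for r \<omega>
  have AEN: "AE \<omega> in M. \<omega> \<in> space M - N"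
    using AE_not_in[OF N(1)] by (auto simp: AE_conj_iff)
  have KH: "AE \<omega> in M. \<forall>r. K r \<omega> = H r \<omega>"
    using AEN by eventually_elim (simp add: K_def)
  have Kcont: "continuous_on {a..b} (\<lambda>r. K r \<omega>)" for \<omega>
    using N(2) by (cases "\<omega> \<in> space M - N") (auto simp: K_def)
  have Kmeas: "K r \<in> borel_measurable M" if "r \<in> {a..b}" for r
    using borel_measurable_integrable[OF int[OF that]] unfolding K_def by measurable
  have Kint: "integrable M (K r)" if "r \<in> {a..b}" for r
    using int[OF that]
    by (subst integrable_cong_AE[where g = "H r"]) (use that Kmeas int KH in auto)
  have KE: "expectation (K r) = expectation (H r)"
    and KEabs: "expectation (\<lambda>\<omega>. \<bar>K r \<omega>\<bar>) = expectation (\<lambda>\<omega>. \<bar>H r \<omega>\<bar>)" if "r \<in> {a..b}" for r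
    using borel_measurable_integrable[OF int[OF that]] Kmeas[OF that] KH
    by (auto intro!: integral_cong_AE)
  interpret P: pair_sigma_finite lborel M ..
  define f where "f p = indicator {a..b} (fst p) * (case p of (r, \<omega>) \<Rightarrow> K (max a (min b r)) \<omega>)" for p
  have fr: "f (r, \<omega>) = indicator {a..b} r * K r \<omega>" for r \<omega>
    by (auto simp: f_def split: split_indicator)
  have fmeas: "f \<in> borel_measurable (lborel \<Otimes>\<^sub>M M)"
    using measurable_continuous_paths[OF ab Kmeas Kcont] unfolding f_def by measurable
  \<comment> \<open>Integrability on the product space follows from the bound \<open>C\<close> on
    the absolute first moments, which is uniform in time, and the finite length of the
    interval.\<close>
  have fint: "integrable (lborel \<Otimes>\<^sub>M M) f"
  proof (rule P.Fubini_integrable[OF fmeas])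
    show "integrable lborel (\<lambda>r. \<integral>\<omega>. norm (f (r, \<omega>)) \<partial>M)"
    proof (rule Bochner_Integration.integrable_bound)
      show "integrable lborel (\<lambda>r::real. indicator {a..b} r * C)"
        using ab by (intro integrable_mult_left) auto
      show "(\<lambda>r. \<integral>\<omega>. norm (f (r, \<omega>)) \<partial>M) \<in> borel_measurable lborel"
        using fmeas by measurable
      show "AE r in lborel. norm (\<integral>\<omega>. norm (f (r, \<omega>)) \<partial>M) \<le> norm (indicator {a..b} r * C)"
      proof (rule AE_I2)
        fix r :: real
        show "norm (\<integral>\<omega>. norm (f (r, \<omega>)) \<partial>M) \<le> norm (indicator {a..b} r * C)"
          using bound[of r] KEabs[of r] by (cases "r \<in> {a..b}") (auto simp: fr)
      qed
    qed
    show "AE r in lborel. integrable M (\<lambda>\<omega>. f (r, \<omega>))"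
      using Kint by (auto simp: fr split: split_indicator)
  qed
  define Z where "Z \<omega> = (\<integral>r. f (r, \<omega>) \<partial>lborel)" for \<omega>
  have Zeq: "Z \<omega> = integral {a..b} (\<lambda>r. K r \<omega>)" for \<omega>
  proof -
    have "set_integrable lborel {a..b} (\<lambda>r. K r \<omega>)"
      using Kcont by (rule borel_integrable_atLeastAtMost')
    from set_borel_integral_eq_integral(2)[OF this] show ?thesis
      by (simp add: Z_def fr set_lebesgue_integral_def)
  qed
  have E: "set_integrable lborel {a..b} (\<lambda>r. expectation (K r))"
    using P.integrable_fst'[OF fint] by (simp add: fr set_integrable_def)
  have "expectation Z = (\<integral>r. (\<integral>\<omega>. f (r, \<omega>) \<partial>M) \<partial>lborel)"
    unfolding Z_def using P.Fubini_integral[of "\<lambda>r \<omega>. f (r, \<omega>)"] fint by simp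
  also have "\<dots> = integral {a..b} (\<lambda>r. expectation (K r))"
    using set_borel_integral_eq_integral(2)[OF E] by (simp add: fr set_lebesgue_integral_def)
  also have "\<dots> = integral {a..b} (\<lambda>r. expectation (H r))"
    by (intro integral_cong KE)
  finally have 4: "expectation Z = integral {a..b} (\<lambda>r. expectation (H r))" .
  show thesis
  proof (rule that[OF _ _ _ 4])
    show "integrable M Z"
      unfolding Z_def using P.integrable_snd[of "\<lambda>r \<omega>. f (r, \<omega>)"] fint by simp
    show "AE \<omega> in M. Z \<omega> = integral {a..b} (\<lambda>r. H r \<omega>)"
      using KH by eventually_elim (simp add: Zeq)
    show "(\<lambda>r. expectation (H r)) integrable_on {a..b}"
      using set_borel_integral_eq_integral(1)[OF E] KE integrable_cong[of "{a..b}"] by metis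
  qed
qed

section \<open>Deterministic estimates\<close>

text \<open>Comparison with the exact solution \<open>z\<close> of z' = K - \<gamma> z that starts
  from \<open>\<phi> s\<close>. No derivative of \<open>\<phi>\<close> is available, so the
  increment inequality is assumed on all subintervals; the argument applies it to the difference
  \<open>d\<close> on the interval starting at the last zero of \<open>d\<close>.\<close>

lemma gronwall_decay:
  fixes \<phi> :: "real \<Rightarrow> real"
  assumes \<gamma>: "0 < \<gamma>" and st: "s \<le> t" and cont: "continuous_on {s..t} \<phi>"
    and ineq: "\<And>a b. s \<le> a \<Longrightarrow> a \<le> b \<Longrightarrow> b \<le> t \<Longrightarrow> \<phi> b - \<phi> a \<le> integral {a..b} (\<lambda>r. K - \<gamma> * \<phi> r)"
  shows "\<phi> t \<le> exp (- \<gamma> * (t - s)) * \<phi> s + (1 - exp (- \<gamma> * (t - s))) / \<gamma> * K"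
proof -
  define z where "z r = exp (- \<gamma> * (r - s)) * (\<phi> s - K / \<gamma>) + K / \<gamma>" for r
  define d where "d r = \<phi> r - z r" for r
  have z': "(z has_vector_derivative K - \<gamma> * z r) (at r within T)" for r T
    unfolding z_def has_real_derivative_iff_has_vector_derivative[symmetric]
    using \<gamma> by (auto intro!: derivative_eq_intros simp: field_simps)
  have zcont: "continuous_on T z" for T
    unfolding z_def by (intro continuous_intros)
  have dcont: "continuous_on {s..t} d"
    unfolding d_def by (intro continuous_intros cont zcont)
  have dineq: "d b - d a \<le> integral {a..b} (\<lambda>r. - \<gamma> * d r)" if "s \<le> a" "a \<le> b" "b \<le> t" for a b
  proof -
    have sub: "{a..b} \<subseteq> {s..t}" using that by auto
    have "((\<lambda>r. K - \<gamma> * z r) has_integral z b - z a) {a..b}"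
      using that z' by (intro fundamental_theorem_of_calculus) auto
    then have "z b - z a = integral {a..b} (\<lambda>r. K - \<gamma> * z r)" by (simp add: integral_unique)
    then have "d b - d a \<le> integral {a..b} (\<lambda>r. K - \<gamma> * \<phi> r) - integral {a..b} (\<lambda>r. K - \<gamma> * z r)"
      using ineq[OF that] by (simp add: d_def)
    also have "\<dots> = integral {a..b} (\<lambda>r. (K - \<gamma> * \<phi> r) - (K - \<gamma> * z r))"
      by (intro Henstock_Kurzweil_Integration.integral_diff[symmetric] integrable_continuous_real continuous_intros
          continuous_on_subset[OF cont sub] zcont)
    also have "\<dots> = integral {a..b} (\<lambda>r. - \<gamma> * d r)"
      by (intro integral_cong) (simp add: d_def algebra_simps)
    finally show ?thesis .
  qed
  \<comment> \<open>Otherwise \<open>d\<close> is nonnegative after its last zero and hence cannot have increased there.\<close>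
  have "d t \<le> 0"
  proof (rule ccontr)
    assume "\<not> d t \<le> 0"
    define A where "A = {r \<in> {s..t}. d r = 0}"
    have "A = {s..t} \<inter> d -` {0}" by (auto simp: A_def)
    then have "compact A"
      using continuous_closed_preimage[OF dcont, of "{0}"]
      by (auto intro: compact_Int_closed simp: compact_eq_bounded_closed intro: bounded_subset[of "{s..t}"])
    moreover have "s \<in> A" using st by (simp add: A_def d_def z_def)
    ultimately obtain a where a: "a \<in> A" "\<And>r. r \<in> A \<Longrightarrow> r \<le> a"
      using compact_attains_sup[of A] by auto
    \<comment> \<open>A negative value at \<open>r\<close> would produce, by the intermediate value
      theorem, a zero of \<open>d\<close> between \<open>r\<close> and \<open>t\<close>. Maximality
      of \<open>a\<close> forces this zero to be \<open>r\<close> itself.\<close>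
    have pos: "0 \<le> d r" if "r \<in> {a..t}" for r
    proof (rule ccontr)
      assume neg: "\<not> 0 \<le> d r"
      have "\<exists>x\<ge>r. x \<le> t \<and> d x = 0"
        using neg \<open>\<not> d t \<le> 0\<close> that a(1)
        by (intro IVT' continuous_on_subset[OF dcont]) (auto simp: A_def)
      then obtain x where x: "r \<le> x" "x \<le> t" "d x = 0" by auto
      with that a have "x \<le> a" by (auto simp: A_def)
      with x that have "x = r" by auto
      with neg x show False by simp
    qed
    have "d t - d a \<le> integral {a..t} (\<lambda>r. - \<gamma> * d r)"
      using a(1) by (intro dineq) (auto simp: A_def)
    also have "\<dots> \<le> integral {a..t} (\<lambda>r. 0)"
      using a(1) pos \<gamma>
      by (intro integral_le integrable_continuous_real continuous_intros continuous_on_subset[OF dcont])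
        (auto simp: A_def)
    finally show False using a(1) \<open>\<not> d t \<le> 0\<close> by (simp add: A_def)
  qed
  then show ?thesis
    using \<gamma> by (simp add: d_def z_def field_simps)
qed

lemma indefinite_integral_has_vector_derivative:
  fixes g :: "real \<Rightarrow> 'a::euclidean_space"
  assumes "continuous_on {s..t} g" "r \<in> {s..t}"
  shows "((\<lambda>x. c + integral {s..x} g) has_vector_derivative g r) (at r within {s..t})"
  using integral_has_vector_derivative[OF assms]
  by (auto intro!: derivative_eq_intros)

lemma norm_square_has_vector_derivative:
  fixes Y :: "real \<Rightarrow> 'a::real_inner"
  assumes "(Y has_vector_derivative y) (at r within T)"
  shows "((\<lambda>r. (norm (Y r))\<^sup>2) has_vector_derivative 2 * (Y r \<bullet> y)) (at r within T)"
  using has_derivative_inner[OF assms[unfolded has_vector_derivative_def] assms[unfolded has_vector_derivative_def]]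
  unfolding power2_norm_eq_inner has_vector_derivative_def
  by (rule has_derivative_eq_rhs) (auto simp: fun_eq_iff inner_commute algebra_simps)

text \<open>Removing \<open>S\<close> from \<open>w\<close> leaves a differentiable curve
  \<open>Y\<close>, to which the ordinary chain rule applies; the square of \<open>Y t + S t\<close>
  is then expanded. Terms are arranged so that \<open>g r\<close> is paired with
  \<open>S t - S r\<close>, which for Brownian noise is an increment after time
  \<open>r\<close>.\<close>

lemma additive_path_energy:
  fixes w g S :: "real \<Rightarrow> 'a::euclidean_space"
  assumes st: "s \<le> t" and g: "continuous_on {s..t} g" and wc: "continuous_on {s..t} w"
    and w: "\<And>r. r \<in> {s..t} \<Longrightarrow> w r = w s + integral {s..r} g + S r"
  shows "(norm (w t))\<^sup>2 = (norm (w s))\<^sup>2 + 2 * integral {s..t} (\<lambda>r. w r \<bullet> g r)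
    + 2 * integral {s..t} (\<lambda>r. g r \<bullet> (S t - S r)) + 2 * (w s \<bullet> S t) + (norm (S t))\<^sup>2"
proof -
  define Y where "Y r = w s + integral {s..r} g" for r
  have Ys: "Y s = w s" by (simp add: Y_def)
  have Y': "(Y has_vector_derivative g r) (at r within {s..t})" if "r \<in> {s..t}" for r
    unfolding Y_def using indefinite_integral_has_vector_derivative[OF g that] .
  have Yc: "continuous_on {s..t} Y"
    using Y' by (rule continuous_on_vector_derivative)
  have S: "S r = w r - Y r" if "r \<in> {s..t}" for r
    using w[OF that] by (simp add: Y_def)
  have Sc: "continuous_on {s..t} S"
    using continuous_on_diff[OF wc Yc] by (subst continuous_on_cong[OF refl S])
  have "((\<lambda>r. 2 * (Y r \<bullet> g r)) has_integral (norm (Y t))\<^sup>2 - (norm (Y s))\<^sup>2) {s..t}"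
    using st Y' by (intro fundamental_theorem_of_calculus norm_square_has_vector_derivative) auto
  then have e1: "(norm (Y t))\<^sup>2 - (norm (w s))\<^sup>2 = integral {s..t} (\<lambda>r. 2 * (Y r \<bullet> g r))"
    by (simp only: integral_unique Ys)
  \<comment> \<open>The cross term of the expanded square is itself an integral over time, which can
    be merged with the one from the chain rule.\<close>
  have "integral {s..t} g \<bullet> S t = integral {s..t} (\<lambda>r. g r \<bullet> S t)"
    using integral_linear[OF integrable_continuous_real[OF g] bounded_linear_inner_left[of "S t"]]
    by (simp add: o_def)
  then have e2: "Y t \<bullet> S t = w s \<bullet> S t + integral {s..t} (\<lambda>r. g r \<bullet> S t)"
    by (simp add: Y_def inner_add_left)
  have "2 * integral {s..t} (\<lambda>r. w r \<bullet> g r) + 2 * integral {s..t} (\<lambda>r. g r \<bullet> (S t - S r))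
    = integral {s..t} (\<lambda>r. 2 * (w r \<bullet> g r)) + integral {s..t} (\<lambda>r. 2 * (g r \<bullet> (S t - S r)))"
    by simp
  also have "\<dots> = integral {s..t} (\<lambda>r. 2 * (w r \<bullet> g r) + 2 * (g r \<bullet> (S t - S r)))"
    by (intro Henstock_Kurzweil_Integration.integral_add[symmetric] integrable_continuous_real continuous_intros g wc Sc)
  also have "\<dots> = integral {s..t} (\<lambda>r. 2 * (Y r \<bullet> g r) + 2 * (g r \<bullet> S t))"
    by (intro integral_cong) (simp add: S inner_diff_left inner_diff_right inner_commute)
  also have "\<dots> = integral {s..t} (\<lambda>r. 2 * (Y r \<bullet> g r)) + integral {s..t} (\<lambda>r. 2 * (g r \<bullet> S t))"
    by (intro Henstock_Kurzweil_Integration.integral_add integrable_continuous_real continuous_intros g Yc)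
  finally have e3: "2 * integral {s..t} (\<lambda>r. w r \<bullet> g r) + 2 * integral {s..t} (\<lambda>r. g r \<bullet> (S t - S r)) =
      integral {s..t} (\<lambda>r. 2 * (Y r \<bullet> g r)) + 2 * integral {s..t} (\<lambda>r. g r \<bullet> S t)"
    by simp
  have "(norm (w t))\<^sup>2 = (norm (Y t))\<^sup>2 + 2 * (Y t \<bullet> S t) + (norm (S t))\<^sup>2"
    using w[of t] st by (simp add: Y_def power2_norm_eq_inner inner_add_left inner_add_right inner_commute)
  then show ?thesis using e1 e2 e3 by simp
qed

lemma sum3_square_le: "(1 + a + b)\<^sup>2 \<le> 3 * (1 + a\<^sup>2 + b\<^sup>2)" for a b :: real
proof -
  have "0 \<le> (a - 1)\<^sup>2 + (b - 1)\<^sup>2 + (a - b)\<^sup>2" by simp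
  then show ?thesis by (simp add: power2_eq_square algebra_simps)
qed

text \<open>A Gronwall bound for the path without its noise, obtained by differentiating the squared
  norm of \<open>Y\<close> with weight \<open>exp (- C * r)\<close>. In \<open>C\<close> the summand
  1 comes from 2 Y.g \<le> |Y|^2 + |g|^2, and \<open>3 * K\<^sup>2\<close> from squaring the
  three-term growth bound. The noise enters only through its squared norm, whose mean is
  known.\<close>

lemma additive_path_growth:
  fixes g S :: "real \<Rightarrow> 'a::euclidean_space"
  assumes t: "0 \<le> t" "t \<le> T" and K: "0 \<le> K"
    and g: "continuous_on {0..t} g" and Sc: "continuous_on {0..t} S"
    and Y: "\<And>r. r \<in> {0..t} \<Longrightarrow> Y r = x + integral {0..r} g"
    and growth: "\<And>r. r \<in> {0..t} \<Longrightarrow> norm (g r) \<le> K * (1 + norm (Y r + S r))"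
  defines "C \<equiv> 1 + 3 * K\<^sup>2"
  shows "(norm (Y t))\<^sup>2 \<le> exp (C * T) * ((norm x)\<^sup>2 + C * (T + integral {0..t} (\<lambda>r. (norm (S r))\<^sup>2)))"
proof -
  have C: "0 \<le> C" by (simp add: C_def)
  have Y': "(Y has_vector_derivative g r) (at r within {0..t})" if "r \<in> {0..t}" for r
    using has_vector_derivative_transform[OF that _ indefinite_integral_has_vector_derivative[OF g that, of x]] Y
    by simp
  have Yc: "continuous_on {0..t} Y"
    using Y' by (rule continuous_on_vector_derivative)
  define D where "D r = exp (- C * r) * (2 * (Y r \<bullet> g r) - C * (norm (Y r))\<^sup>2)" for r
  have "(D has_integral exp (- C * t) * (norm (Y t))\<^sup>2 - exp (- C * 0) * (norm (Y 0))\<^sup>2) {0..t}"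
  proof (rule fundamental_theorem_of_calculus[OF t(1)])
    fix r assume r: "r \<in> {0..t}"
    show "((\<lambda>r. exp (- C * r) * (norm (Y r))\<^sup>2) has_vector_derivative D r) (at r within {0..t})"
      unfolding has_real_derivative_iff_has_vector_derivative[symmetric] D_def
    proof (rule DERIV_cong[OF DERIV_mult'])
      show "((\<lambda>r. exp (- C * r)) has_real_derivative - C * exp (- C * r)) (at r within {0..t})"
        by (auto intro!: derivative_eq_intros)
      show "((\<lambda>r. (norm (Y r))\<^sup>2) has_real_derivative 2 * (Y r \<bullet> g r)) (at r within {0..t})"
        using norm_square_has_vector_derivative[OF Y'[OF r]]
        by (simp add: has_real_derivative_iff_has_vector_derivative)
    qed (simp add: algebra_simps)
  qed
  moreover have "((\<lambda>r. C * (1 + (norm (S r))\<^sup>2)) has_integral integral {0..t} (\<lambda>r. C * (1 + (norm (S r))\<^sup>2))) {0..t}"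
    by (intro integrable_integral integrable_continuous_real continuous_intros Sc)
  moreover have "D r \<le> C * (1 + (norm (S r))\<^sup>2)" if r: "r \<in> {0..t}" for r
  proof -
    have "norm (g r) \<le> K * (1 + norm (Y r) + norm (S r))"
      using growth[OF r] mult_left_mono[OF norm_triangle_ineq[of "Y r" "S r"] K] by (simp add: algebra_simps)
    then have "(norm (g r))\<^sup>2 \<le> (K * (1 + norm (Y r) + norm (S r)))\<^sup>2"
      by (intro power_mono) auto
    also have "\<dots> \<le> K\<^sup>2 * (3 * (1 + (norm (Y r))\<^sup>2 + (norm (S r))\<^sup>2))"
      unfolding power_mult_distrib by (intro mult_left_mono sum3_square_le) auto
    finally have "(norm (g r))\<^sup>2 \<le> 3 * K\<^sup>2 * (1 + (norm (Y r))\<^sup>2 + (norm (S r))\<^sup>2)" by (simp only: mult_ac)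
    moreover have "2 * (Y r \<bullet> g r) \<le> (norm (Y r))\<^sup>2 + (norm (g r))\<^sup>2"
      using norm_cauchy_schwarz[of "Y r" "g r"] sum_squares_bound[of "norm (Y r)" "norm (g r)"] by linarith
    ultimately have le: "2 * (Y r \<bullet> g r) - C * (norm (Y r))\<^sup>2 \<le> C * (1 + (norm (S r))\<^sup>2)"
      using zero_le_power2[of "norm (S r)"] unfolding C_def distrib_left distrib_right by linarith
    have "D r \<le> exp (- C * r) * (C * (1 + (norm (S r))\<^sup>2))"
      unfolding D_def by (intro mult_left_mono le) auto
    also have "\<dots> \<le> 1 * (C * (1 + (norm (S r))\<^sup>2))"
      using r C by (intro mult_right_mono) auto
    finally show ?thesis by simp
  qed
  ultimately have "exp (- C * t) * (norm (Y t))\<^sup>2 - exp (- C * 0) * (norm (Y 0))\<^sup>2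
      \<le> integral {0..t} (\<lambda>r. C * (1 + (norm (S r))\<^sup>2))"
    by (rule has_integral_le)
  also have "\<dots> = C * (t + integral {0..t} (\<lambda>r. (norm (S r))\<^sup>2))"
    using t by (subst integral_mult_right, subst Henstock_Kurzweil_Integration.integral_add)
      (auto intro!: integrable_continuous_real continuous_intros Sc)
  also have "\<dots> \<le> C * (T + integral {0..t} (\<lambda>r. (norm (S r))\<^sup>2))"
    using t C by (intro mult_left_mono) auto
  finally have le: "exp (- C * t) * (norm (Y t))\<^sup>2 \<le> (norm x)\<^sup>2 + C * (T + integral {0..t} (\<lambda>r. (norm (S r))\<^sup>2))"
    using Y[of 0] t by simp
  have "(norm (Y t))\<^sup>2 = exp (C * t) * (exp (- C * t) * (norm (Y t))\<^sup>2)"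
    by (simp add: exp_minus)
  also have "\<dots> \<le> exp (C * T) * ((norm x)\<^sup>2 + C * (T + integral {0..t} (\<lambda>r. (norm (S r))\<^sup>2)))"
    using t C by (intro mult_mono le) (auto intro: mult_left_mono)
  finally show ?thesis .
qed

section \<open>Coercivity and the cutoff surrogate\<close>

text \<open>First-order optimality: the nonnegative form \<open>q\<close> vanishes at
  \<open>z\<close>, and a step \<open>t\<close> along the residual \<open>r\<close> changes it by 2
  t |r|^2 to first order. A nonzero residual would therefore permit negative values.\<close>

lemma sym_quadratic_form_minimum_eigenvector:
  fixes A :: "real ^ 'd ^ 'd"
  assumes sym: "transpose A = A" and z: "norm z = 1"
    and min: "\<And>y. m * (norm y)\<^sup>2 \<le> y \<bullet> (A *v y)" and eq: "z \<bullet> (A *v z) = m"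
  shows "A *v z = m *\<^sub>R z"
proof -
  define r where "r = A *v z - m *\<^sub>R z"
  define q where "q y = y \<bullet> (A *v y) - m * (y \<bullet> y)" for y
  have q0: "0 \<le> q y" for y using min[of y] by (simp add: q_def power2_norm_eq_inner)
  have symi: "x \<bullet> (A *v y) = y \<bullet> (A *v x)" for x y
    using dot_lmul_matrix[of x A y] sym by (metis inner_commute transpose_matrix_vector)
  have zz: "z \<bullet> z = 1" using z by (simp add: norm_eq_sqrt_inner)
  have qz: "q (z + t *\<^sub>R r) = 2 * t * (r \<bullet> r) + t\<^sup>2 * q r" for t
  proof -
    have "q (z + t *\<^sub>R r) = q z + 2 * t * (r \<bullet> (A *v z) - m * (r \<bullet> z)) + t\<^sup>2 * q r"
      unfolding q_def using symi[of z r]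
      by (simp add: matrix_vector_right_distrib matrix_vector_mult_scaleR inner_add_left inner_add_right
          power2_eq_square inner_commute[of z r] algebra_simps)
    also have "r \<bullet> (A *v z) - m * (r \<bullet> z) = r \<bullet> r"
      by (simp add: r_def inner_diff_right)
    finally show ?thesis using eq zz by (simp add: q_def)
  qed
  \<comment> \<open>Otherwise \<open>q (z + t r) < 0\<close> for a small negative \<open>t\<close>.\<close>
  have "r \<bullet> r = 0"
  proof (rule ccontr)
    assume "r \<bullet> r \<noteq> 0"
    then have pos: "0 < r \<bullet> r" by simp
    \<comment> \<open>This step satisfies t q(r) \<ge> - r.r, so the linear term dominates. Adding
      \<open>r \<bullet> r\<close> to the denominator keeps it positive even when
      \<open>q r = 0\<close>.\<close>
    define t where "t = - (r \<bullet> r) / (q r + r \<bullet> r)"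
    have den: "0 < q r + r \<bullet> r" using q0[of r] pos by linarith
    have t: "t < 0" using den pos by (simp add: t_def divide_neg_pos)
    have "0 \<le> t * (2 * (r \<bullet> r) + t * q r)" using q0[of "z + t *\<^sub>R r"] unfolding qz
      by (simp add: power2_eq_square algebra_simps)
    then have "2 * (r \<bullet> r) + t * q r \<le> 0" using t by (simp add: zero_le_mult_iff)
    moreover have "t * q r \<ge> - (r \<bullet> r)"
    proof -
      have "q r / (q r + r \<bullet> r) \<le> 1" using den pos by simp
      then have "(r \<bullet> r) * (q r / (q r + r \<bullet> r)) \<le> r \<bullet> r"
        using pos mult_left_mono[of "q r / (q r + r \<bullet> r)" 1 "r \<bullet> r"] by simp
      then show ?thesis by (simp add: t_def)
    qed
    ultimately show False using pos by linarith
  qed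
  then show ?thesis by (simp add: r_def)
qed

text \<open>The quadratic form attains a minimum on the compact unit sphere. By homogeneity this is
  a global quadratic lower bound, and by the preceding lemma the minimum is an eigenvalue, hence at
  least \<open>lam\<close>.\<close>

lemma smallest_eigenvalue_coercive:
  fixes A :: "real ^ 'd ^ 'd"
  assumes sym: "transpose A = A" and lam: "is_smallest_eigenvalue A lam"
  shows "lam * (norm z)\<^sup>2 \<le> z \<bullet> (A *v z)"
proof -
  define Q where "Q y = y \<bullet> (A *v y)" for y
  have cont: "continuous_on T Q" for T
    unfolding Q_def by (intro continuous_intros linear_continuous_on matrix_vector_mul_bounded_linear)
  have "(axis undefined 1 :: real ^ 'd) \<in> sphere 0 1" by simp
  then obtain y where y: "y \<in> sphere 0 1" "\<And>x. x \<in> sphere 0 1 \<Longrightarrow> Q y \<le> Q x"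
    using continuous_attains_inf[OF compact_sphere _ cont, of "0::real ^ 'd" 1] by blast
  have hom: "Q (c *\<^sub>R x) = c\<^sup>2 * Q x" for c x
    by (simp add: Q_def matrix_vector_mult_scaleR power2_eq_square)
  have min: "Q y * (norm x)\<^sup>2 \<le> Q x" for x
  proof (cases "x = 0")
    case False
    have "Q y \<le> Q (inverse (norm x) *\<^sub>R x)"
      using False by (intro y(2)) simp
    then show ?thesis
      using False by (simp add: hom field_simps)
  qed (simp add: Q_def)
  have "A *v y = Q y *\<^sub>R y"
    using y(1) min by (intro sym_quadratic_form_minimum_eigenvector[OF sym]) (auto simp: Q_def)
  moreover have "y \<noteq> 0" using y(1) by auto
  ultimately have "lam \<le> Q y"
    using lam by (auto simp: is_smallest_eigenvalue_def is_eigenvalue_def)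
  then have "lam * (norm z)\<^sup>2 \<le> Q y * (norm z)\<^sup>2" by (intro mult_right_mono) auto
  with min[of z] show ?thesis by (simp add: Q_def)
qed

lemma V_norm_square:
  assumes "sym_pos_def A"
  shows "(V_norm A z)\<^sup>2 = z \<bullet> (A *v z)" and "0 \<le> V_norm A z"
proof -
  have "0 \<le> z \<bullet> (A *v z)"
    using assms by (cases "z = 0") (auto simp: sym_pos_def_def less_imp_le)
  then show "(V_norm A z)\<^sup>2 = z \<bullet> (A *v z)" "0 \<le> V_norm A z" by (simp_all add: V_norm_def)
qed

lemma linear_dissipation_coercive:
  assumes "linear_dissipation A lam"
  shows "lam * (norm z)\<^sup>2 \<le> (V_norm A z)\<^sup>2"
  using assms smallest_eigenvalue_coercive[of A lam z]
  by (auto simp: linear_dissipation_def V_norm_square(1) sym_pos_def_def)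

lemma continuous_on_V_norm: "continuous_on T (V_norm A)"
  unfolding V_norm_def by (intro continuous_intros linear_continuous_on matrix_vector_mul_bounded_linear)

lemma compact_V_ball:
  assumes "linear_dissipation A lam"
  shows "compact {z. V_norm A z \<le> R}"
  unfolding compact_eq_bounded_closed
proof
  have lam: "0 < lam" and spd: "sym_pos_def A" using assms by (auto simp: linear_dissipation_def)
  show "bounded {z. V_norm A z \<le> R}"
    unfolding bounded_iff
  proof (intro exI ballI)
    fix z assume "z \<in> {z. V_norm A z \<le> R}"
    then have "(V_norm A z)\<^sup>2 \<le> R\<^sup>2"
      using V_norm_square(2)[OF spd, of z] by (intro power_mono) auto
    then have "(norm z)\<^sup>2 \<le> R\<^sup>2 / lam"
      using linear_dissipation_coercive[OF assms, of z] lam by (simp add: field_simps)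
    then show "norm z \<le> sqrt (R\<^sup>2 / lam)" by (rule real_le_rsqrt)
  qed
  have "{z. V_norm A z \<le> R} = V_norm A -` {..R}" by auto
  then show "closed {z. V_norm A z \<le> R}"
    using continuous_on_V_norm[of UNIV A] by (auto intro: closed_vimage)
qed

lemma cutoff_surrogate_outside:
  assumes "sym_pos_def A" "cutoff_profile R R' \<psi>" "0 \<le> R'" "R' \<le> V_norm A z"
  shows "cutoff_surrogate A \<psi> f B Fhat z = f - B *v z"
proof -
  have "R'\<^sup>2 \<le> (V_norm A z)\<^sup>2" using assms by (intro power_mono)
  then show ?thesis using assms by (simp add: cutoff_surrogate_def cutoff_profile_def)
qed

text \<open>The space is covered by two open sets: \<open>G\<close>, where all ingredients are
  continuous, and the exterior of the closed V-ball of radius \<open>R'\<close>, where the surrogate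
  is the affine field.\<close>

lemma continuous_on_cutoff_surrogate:
  fixes Fhat :: "real ^ 'd \<Rightarrow> real ^ 'd"
  assumes spd: "sym_pos_def A" and cutoff: "cutoff_profile R R' \<psi>" and R': "0 \<le> R'"
    and G: "open G" "{z. V_norm A z \<le> R'} \<subseteq> G" and lip: "locally_lipschitz_on G Fhat"
  shows "continuous_on UNIV (cutoff_surrogate A \<psi> f B Fhat)"
proof -
  let ?F = "cutoff_surrogate A \<psi> f B Fhat"
  obtain D where D: "\<forall>r\<ge>0. D 0 r = \<psi> r"
    "\<forall>n. \<forall>r\<ge>0. ((D n :: real \<Rightarrow> real) has_real_derivative D (Suc n) r) (at r within {0..})"
    using cutoff unfolding cutoff_profile_def smooth_on_halfline_def by blast
  have "continuous_on {0..} (D 0)"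
    using D(2) by (intro DERIV_continuous_on) auto
  then have \<psi>: "continuous_on {0..} \<psi>"
    using D(1) by (auto intro: continuous_on_eq)
  have c: "continuous_on T (\<lambda>z. \<psi> ((V_norm A z)\<^sup>2))" for T
    by (rule continuous_on_compose2[OF \<psi>]) (auto intro!: continuous_intros continuous_on_V_norm)
  have Bc: "continuous_on T (\<lambda>z. f - B *v z)" for T
    by (intro continuous_intros linear_continuous_on matrix_vector_mul_bounded_linear)
  have Fh: "continuous_on G Fhat"
    using lip unfolding locally_lipschitz_on_def by (rule local_lipschitz_continuous_on) simp
  have 1: "continuous_on G ?F"
    unfolding cutoff_surrogate_def Let_def by (intro continuous_intros c Bc Fh)
  have 2: "continuous_on {z. R' < V_norm A z} ?F"
    by (rule continuous_on_eq[OF Bc]) (simp add: cutoff_surrogate_outside[OF spd cutoff R'])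
  have "{z. R' < V_norm A z} = V_norm A -` {R'<..}" by auto
  then have "open {z. R' < V_norm A z}"
    using continuous_on_V_norm[of UNIV A] by (auto intro: open_vimage)
  then have "continuous_on (G \<union> {z. R' < V_norm A z}) ?F"
    using G(1) 1 2 by (intro continuous_on_open_Un)
  moreover have "G \<union> {z. R' < V_norm A z} = UNIV" using G(2) by force
  ultimately show ?thesis by simp
qed

text \<open>On the compact V-ball continuity gives a bound, and outside it the field is affine.
  Linear growth is what the second-moment estimates below rest on.\<close>

lemma cutoff_surrogate_linear_growth:
  fixes Fhat :: "real ^ 'd \<Rightarrow> real ^ 'd"
  assumes diss: "linear_dissipation A lam" and cutoff: "cutoff_profile R R' \<psi>" and R': "0 \<le> R'"
    and cont: "continuous_on UNIV (cutoff_surrogate A \<psi> f B Fhat)"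
  obtains K where "0 \<le> K" "\<And>z. norm (cutoff_surrogate A \<psi> f B Fhat z) \<le> K * (1 + norm z)"
proof -
  let ?F = "cutoff_surrogate A \<psi> f B Fhat"
  have spd: "sym_pos_def A" using diss by (simp add: linear_dissipation_def)
  have "bounded (?F ` {z. V_norm A z \<le> R'})"
    using compact_V_ball[OF diss] continuous_on_subset[OF cont]
    by (intro compact_imp_bounded compact_continuous_image) auto
  then obtain b where b: "0 < b" "\<And>z. V_norm A z \<le> R' \<Longrightarrow> norm (?F z) \<le> b"
    unfolding bounded_pos by auto
  obtain c where c: "0 < c" "\<And>z. norm (B *v z) \<le> norm z * c"
    using bounded_linear.pos_bounded[OF matrix_vector_mul_bounded_linear[of B]] by auto
  show thesis
  proof (rule that)
    show "0 \<le> b + norm f + c" using b c by simp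
    fix z
    show "norm (?F z) \<le> (b + norm f + c) * (1 + norm z)"
    proof (cases "V_norm A z \<le> R'")
      case True
      have "norm (?F z) \<le> b * 1" using b(2)[OF True] by simp
      also have "\<dots> \<le> (b + norm f + c) * (1 + norm z)" using b c by (intro mult_mono) auto
      finally show ?thesis .
    next
      case False
      then have "norm (?F z) \<le> norm f + norm z * c"
        using cutoff_surrogate_outside[OF spd cutoff R'] c(2)[of z] norm_triangle_ineq4[of f "B *v z"] by simp
      also have "\<dots> \<le> (b + norm f + c) * (1 + norm z)"
        using b(1) c(1) by (simp add: algebra_simps)
      finally show ?thesis .
    qed
  qed
qed

section \<open>The mean energy identity\<close>

lemma trace_mult_transpose_nonneg:
  fixes G :: "real ^ 'k ^ 'd"
  shows "0 \<le> trace (G ** transpose G)"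
  by (simp add: trace_mult_transpose sum_nonneg)

lemma norm_add_square_le: "(norm (x + y))\<^sup>2 \<le> 2 * (norm x)\<^sup>2 + 2 * (norm y)\<^sup>2"
  for x y :: "'a::real_normed_vector"
proof -
  have "(norm (x + y))\<^sup>2 \<le> (norm x + norm y)\<^sup>2"
    by (intro power_mono norm_triangle_ineq) simp
  also have "\<dots> \<le> 2 * (norm x)\<^sup>2 + 2 * (norm y)\<^sup>2"
    using sum_squares_bound[of "norm x" "norm y"] by (simp add: power2_eq_square algebra_simps)
  finally show ?thesis .
qed

lemma abs_inner_le_squares: "\<bar>x \<bullet> y\<bar> \<le> (norm x)\<^sup>2 + (norm y)\<^sup>2" for x y :: "'a::real_inner"
  using Cauchy_Schwarz_ineq2[of x y] sum_squares_bound[of "norm x" "norm y"]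
    zero_le_power2[of "norm x"] zero_le_power2[of "norm y"] by linarith

context brownian
begin

lemma W_continuous: "AE \<omega> in M. continuous_on {0..} (\<lambda>t. W t \<omega>)"
  using BM by (simp add: standard_brownian_motion_def)

text \<open>The pathwise growth bound dominates the squared norm of the solution by the squared
  noise and its time integral. The Ito isometry and Fubini make both integrable, with means bounded
  uniformly on \<open>{0..T}\<close>.\<close>

lemma square_integrable_additive_solution:
  fixes v b :: "real \<Rightarrow> 'w \<Rightarrow> real ^ 'd" and G :: "real ^ 'k ^ 'd"
  assumes T: "0 \<le> T" and K: "0 \<le> K"
    and v: "\<And>r. r \<in> {0..T} \<Longrightarrow> v r \<in> borel_measurable M"
    and b: "AE \<omega> in M. continuous_on {0..T} (\<lambda>r. b r \<omega>)"
    and growth: "\<And>r \<omega>. r \<in> {0..T} \<Longrightarrow> norm (b r \<omega>) \<le> K * (1 + norm (v r \<omega>))"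
    and sol: "AE \<omega> in M. \<forall>r\<in>{0..T}. v r \<omega> = x + integral {0..r} (\<lambda>s. b s \<omega>) + G *v (W r \<omega> - W 0 \<omega>)"
  shows "\<exists>C. \<forall>r\<in>{0..T}. integrable M (\<lambda>\<omega>. (norm (v r \<omega>))\<^sup>2) \<and> expectation (\<lambda>\<omega>. (norm (v r \<omega>))\<^sup>2) \<le> C"
proof -
  define S where "S r \<omega> = G *v (W r \<omega> - W 0 \<omega>)" for r \<omega>
  define L where "L = 1 + 3 * K\<^sup>2"
  define \<tau> where "\<tau> = trace (G ** transpose G)"
  have \<tau>: "0 \<le> \<tau>" unfolding \<tau>_def by (rule trace_mult_transpose_nonneg)
  have L: "0 \<le> L" by (simp add: L_def)
  have S: "integrable M (\<lambda>\<omega>. (norm (S r \<omega>))\<^sup>2)" "expectation (\<lambda>\<omega>. (norm (S r \<omega>))\<^sup>2) = r * \<tau>" if "0 \<le> r" for r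
    using increment_square_integrable[of 0 r G] increment_square_expectation[of 0 r G] that
    by (simp_all add: S_def \<tau>_def)
  have Scont: "AE \<omega> in M. continuous_on {0..} (\<lambda>r. S r \<omega>)"
    using W_continuous
  proof eventually_elim
    case (elim \<omega>)
    then show ?case unfolding S_def
      by (intro bounded_linear.continuous_on[OF matrix_vector_mul_bounded_linear] continuous_intros)
  qed
  \<comment> \<open>The factors 2 stem from |Y + S|^2 \<le> 2 |Y|^2 + 2 |S|^2.
    \<open>T * \<tau>\<close> bounds the mean of |S|^2, and \<open>T * (T * \<tau>)\<close> that of
    its time integral.\<close>
  define C where "C = 2 * (exp (L * T) * ((norm x)\<^sup>2 + L * (T + T * (T * \<tau>)))) + 2 * (T * \<tau>)"
  have "integrable M (\<lambda>\<omega>. (norm (v r \<omega>))\<^sup>2) \<and> expectation (\<lambda>\<omega>. (norm (v r \<omega>))\<^sup>2) \<le> C" if r: "r \<in> {0..T}" for r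
  proof -
    have S2cont: "AE \<omega> in M. continuous_on {0..r} (\<lambda>s. (norm (S s \<omega>))\<^sup>2)"
      using Scont by eventually_elim (auto intro!: continuous_intros elim: continuous_on_subset)
    have "\<And>s. s \<in> {0..r} \<Longrightarrow> expectation (\<lambda>\<omega>. \<bar>(norm (S s \<omega>))\<^sup>2\<bar>) \<le> T * \<tau>"
      using S(2) r \<tau> by (auto intro: mult_right_mono)
    then obtain Z where Z: "integrable M Z" "AE \<omega> in M. Z \<omega> = integral {0..r} (\<lambda>s. (norm (S s \<omega>))\<^sup>2)"
      "(\<lambda>s. expectation (\<lambda>\<omega>. (norm (S s \<omega>))\<^sup>2)) integrable_on {0..r}"
      "expectation Z = integral {0..r} (\<lambda>s. expectation (\<lambda>\<omega>. (norm (S s \<omega>))\<^sup>2))"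
      using fubini_continuous_paths[of 0 r "\<lambda>s \<omega>. (norm (S s \<omega>))\<^sup>2" "T * \<tau>"] S(1) S2cont r by auto
    have "expectation Z \<le> integral {0..r} (\<lambda>s. T * \<tau>)"
      unfolding Z(4) using Z(3) S(2) r \<tau> by (intro integral_le) (auto intro: mult_right_mono)
    also have "\<dots> = r * (T * \<tau>)"
      using r by simp
    also have "\<dots> \<le> T * (T * \<tau>)"
      using r \<tau> T by (intro mult_right_mono) auto
    finally have EZ: "expectation Z \<le> T * (T * \<tau>)" .
    define B where "B \<omega> = 2 * (exp (L * T) * ((norm x)\<^sup>2 + L * (T + Z \<omega>))) + 2 * (norm (S r \<omega>))\<^sup>2" for \<omega>
    have Bint: "integrable M B"
      unfolding B_def using Z(1) S(1) r by auto
    have le: "AE \<omega> in M. (norm (v r \<omega>))\<^sup>2 \<le> B \<omega>"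
      using b Scont sol Z(2)
    proof eventually_elim
      case (elim \<omega>)
      define Y where "Y s = x + integral {0..s} (\<lambda>s. b s \<omega>)" for s
      have v_eq: "v s \<omega> = Y s + S s \<omega>" if "s \<in> {0..r}" for s
        using elim(3) that r by (simp add: Y_def S_def)
      have "(norm (Y r))\<^sup>2 \<le> exp (L * T) * ((norm x)\<^sup>2 + L * (T + integral {0..r} (\<lambda>s. (norm (S s \<omega>))\<^sup>2)))"
        unfolding L_def
      proof (rule additive_path_growth[where g = "\<lambda>s. b s \<omega>"])
        show "continuous_on {0..r} (\<lambda>s. b s \<omega>)" "continuous_on {0..r} (\<lambda>s. S s \<omega>)"
          using elim(1,2) r by (auto elim: continuous_on_subset)
        show "norm (b s \<omega>) \<le> K * (1 + norm (Y s + S s \<omega>))" if "s \<in> {0..r}" for s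
          using growth[of s \<omega>] that r v_eq[OF that] by simp
      qed (use r K Y_def in auto)
      moreover have "(norm (v r \<omega>))\<^sup>2 \<le> 2 * (norm (Y r))\<^sup>2 + 2 * (norm (S r \<omega>))\<^sup>2"
        using v_eq[of r] norm_add_square_le[of "Y r" "S r \<omega>"] r by simp
      ultimately show ?case
        using elim(4) by (simp add: B_def)
    qed
    have vmeas: "(\<lambda>\<omega>. (norm (v r \<omega>))\<^sup>2) \<in> borel_measurable M"
      using v[OF r] by measurable
    have vint: "integrable M (\<lambda>\<omega>. (norm (v r \<omega>))\<^sup>2)"
      using le by (intro Bochner_Integration.integrable_bound[OF Bint vmeas]) (auto elim: eventually_mono)
    have "expectation (\<lambda>\<omega>. (norm (v r \<omega>))\<^sup>2) \<le> expectation B"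
      using le by (intro integral_mono_AE vint Bint)
    also have "\<dots> = 2 * (exp (L * T) * ((norm x)\<^sup>2 + L * (T + expectation Z))) + 2 * (r * \<tau>)"
      unfolding B_def using Z(1) S r by (simp add: prob_space)
    also have "\<dots> \<le> C"
      unfolding C_def using EZ r \<tau> L by (intro add_mono mult_left_mono mult_right_mono) auto
    finally show ?thesis using vint by simp
  qed
  then show ?thesis by blast
qed

text \<open>This is the expectation of the pathwise energy identity. Noise increments are orthogonal
  to \<open>w s\<close> and to each \<open>g r\<close> from their past, so only the variance of the
  total increment remains. The common moment bound \<open>C\<close> justifies exchanging time
  integral and expectation.\<close>

lemma additive_energy_identity:
  fixes w g :: "real \<Rightarrow> 'w \<Rightarrow> real ^ 'd" and G :: "real ^ 'k ^ 'd"
  assumes st: "0 \<le> s" "s \<le> t"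
    and w: "\<And>r. r \<in> {s..t} \<Longrightarrow> w r \<in> borel_measurable (Fl r)"
    and g: "\<And>r. r \<in> {s..t} \<Longrightarrow> g r \<in> borel_measurable (Fl r)"
    and w2: "\<And>r. r \<in> {s..t} \<Longrightarrow> integrable M (\<lambda>\<omega>. (norm (w r \<omega>))\<^sup>2)"
      "\<And>r. r \<in> {s..t} \<Longrightarrow> expectation (\<lambda>\<omega>. (norm (w r \<omega>))\<^sup>2) \<le> C"
    and g2: "\<And>r. r \<in> {s..t} \<Longrightarrow> integrable M (\<lambda>\<omega>. (norm (g r \<omega>))\<^sup>2)"
      "\<And>r. r \<in> {s..t} \<Longrightarrow> expectation (\<lambda>\<omega>. (norm (g r \<omega>))\<^sup>2) \<le> C"
    and wcont: "AE \<omega> in M. continuous_on {s..t} (\<lambda>r. w r \<omega>)"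
    and gcont: "AE \<omega> in M. continuous_on {s..t} (\<lambda>r. g r \<omega>)"
    and sol: "AE \<omega> in M. \<forall>r\<in>{s..t}. w r \<omega> = w s \<omega> + integral {s..r} (\<lambda>x. g x \<omega>) + G *v (W r \<omega> - W s \<omega>)"
  shows "(\<lambda>r. expectation (\<lambda>\<omega>. w r \<omega> \<bullet> g r \<omega>)) integrable_on {s..t}"
    and "expectation (\<lambda>\<omega>. (norm (w t \<omega>))\<^sup>2) = expectation (\<lambda>\<omega>. (norm (w s \<omega>))\<^sup>2)
      + 2 * integral {s..t} (\<lambda>r. expectation (\<lambda>\<omega>. w r \<omega> \<bullet> g r \<omega>)) + (t - s) * trace (G ** transpose G)"
proof -
  define \<tau> where "\<tau> = trace (G ** transpose G)"
  have \<tau>: "0 \<le> \<tau>" unfolding \<tau>_def by (rule trace_mult_transpose_nonneg)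
  have wM: "w r \<in> borel_measurable M" and gM: "g r \<in> borel_measurable M" if "r \<in> {s..t}" for r
    using w[OF that] g[OF that] st that by (auto intro: adapted_measurable)
  define J where "J r \<omega> = G *v (W t \<omega> - W r \<omega>)" for r \<omega>
  have JM: "J r \<in> borel_measurable M" if "r \<in> {s..t}" for r
    unfolding J_def using st that
    by (intro measurable_compose[OF increment_measurable borel_measurable_continuous_onI]
        linear_continuous_on matrix_vector_mul_bounded_linear) auto
  have J2: "integrable M (\<lambda>\<omega>. (norm (J r \<omega>))\<^sup>2)"
    "expectation (\<lambda>\<omega>. (norm (J r \<omega>))\<^sup>2) = (t - r) * \<tau>" if "r \<in> {s..t}" for r
    using increment_square_integrable[of r t G] increment_square_expectation[of r t G] that st
    by (simp_all add: J_def \<tau>_def)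
  have Jcont: "AE \<omega> in M. continuous_on {s..t} (\<lambda>r. J r \<omega>)"
    using W_continuous
  proof eventually_elim
    case (elim \<omega>)
    then have "continuous_on {s..t} (\<lambda>r. W r \<omega>)" using st by (auto elim: continuous_on_subset)
    then show ?case unfolding J_def
      by (intro bounded_linear.continuous_on[OF matrix_vector_mul_bounded_linear] continuous_intros)
  qed
  have orth: "expectation (\<lambda>\<omega>. X \<omega> \<bullet> J r \<omega>) = 0"
    if "r \<in> {s..t}" "X \<in> borel_measurable (Fl r)" "integrable M (\<lambda>\<omega>. (norm (X \<omega>))\<^sup>2)" for X :: "'w \<Rightarrow> real ^ 'd" and r
    unfolding J_def using that st by (intro increment_orthogonal) auto
  \<comment> \<open>Besides integrability this yields the bound on the absolute mean that the Fubini
    lemma asks for.\<close>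
  have inner: "integrable M (\<lambda>\<omega>. X \<omega> \<bullet> Y \<omega>) \<and> expectation (\<lambda>\<omega>. \<bar>X \<omega> \<bullet> Y \<omega>\<bar>) \<le> a + c"
    if "X \<in> borel_measurable M" "Y \<in> borel_measurable M"
      "integrable M (\<lambda>\<omega>. (norm (X \<omega>))\<^sup>2)" "integrable M (\<lambda>\<omega>. (norm (Y \<omega>))\<^sup>2)"
      "expectation (\<lambda>\<omega>. (norm (X \<omega>))\<^sup>2) \<le> a" "expectation (\<lambda>\<omega>. (norm (Y \<omega>))\<^sup>2) \<le> c"
    for X Y :: "'w \<Rightarrow> real ^ 'd" and a c
  proof
    show int: "integrable M (\<lambda>\<omega>. X \<omega> \<bullet> Y \<omega>)"
      using that by (intro integrable_inner_of_square)
    have "expectation (\<lambda>\<omega>. \<bar>X \<omega> \<bullet> Y \<omega>\<bar>) \<le> expectation (\<lambda>\<omega>. (norm (X \<omega>))\<^sup>2 + (norm (Y \<omega>))\<^sup>2)"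
      using that int by (intro integral_mono abs_inner_le_squares) auto
    also have "\<dots> \<le> a + c" using that by simp
    finally show "expectation (\<lambda>\<omega>. \<bar>X \<omega> \<bullet> Y \<omega>\<bar>) \<le> a + c" .
  qed
  have wg_cont: "AE \<omega> in M. continuous_on {s..t} (\<lambda>r. w r \<omega> \<bullet> g r \<omega>)"
    using wcont gcont by eventually_elim (intro continuous_intros)
  have wg: "integrable M (\<lambda>\<omega>. w r \<omega> \<bullet> g r \<omega>)" "expectation (\<lambda>\<omega>. \<bar>w r \<omega> \<bullet> g r \<omega>\<bar>) \<le> C + C"
    if r: "r \<in> {s..t}" for r
    using inner[OF wM[OF r] gM[OF r] w2(1)[OF r] g2(1)[OF r] w2(2)[OF r] g2(2)[OF r]] by auto
  obtain Z1 where Z1: "integrable M Z1" "AE \<omega> in M. Z1 \<omega> = integral {s..t} (\<lambda>r. w r \<omega> \<bullet> g r \<omega>)"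
    "(\<lambda>r. expectation (\<lambda>\<omega>. w r \<omega> \<bullet> g r \<omega>)) integrable_on {s..t}"
    "expectation Z1 = integral {s..t} (\<lambda>r. expectation (\<lambda>\<omega>. w r \<omega> \<bullet> g r \<omega>))"
    by (rule fubini_continuous_paths[OF st(2) wg(1) wg_cont wg(2)])
  have gJ_cont: "AE \<omega> in M. continuous_on {s..t} (\<lambda>r. g r \<omega> \<bullet> J r \<omega>)"
    using gcont Jcont by eventually_elim (intro continuous_intros)
  have gJ: "integrable M (\<lambda>\<omega>. g r \<omega> \<bullet> J r \<omega>)"
    "expectation (\<lambda>\<omega>. \<bar>g r \<omega> \<bullet> J r \<omega>\<bar>) \<le> C + (t - s) * \<tau>" if r: "r \<in> {s..t}" for r
  proof -
    have "expectation (\<lambda>\<omega>. (norm (J r \<omega>))\<^sup>2) \<le> (t - s) * \<tau>"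
      using J2(2)[OF r] r \<tau> by (auto intro: mult_right_mono)
    from inner[OF gM[OF r] JM[OF r] g2(1)[OF r] J2(1)[OF r] g2(2)[OF r] this]
    show "integrable M (\<lambda>\<omega>. g r \<omega> \<bullet> J r \<omega>)" "expectation (\<lambda>\<omega>. \<bar>g r \<omega> \<bullet> J r \<omega>\<bar>) \<le> C + (t - s) * \<tau>"
      by auto
  qed
  obtain Z2 where Z2: "integrable M Z2" "AE \<omega> in M. Z2 \<omega> = integral {s..t} (\<lambda>r. g r \<omega> \<bullet> J r \<omega>)"
    "(\<lambda>r. expectation (\<lambda>\<omega>. g r \<omega> \<bullet> J r \<omega>)) integrable_on {s..t}"
    "expectation Z2 = integral {s..t} (\<lambda>r. expectation (\<lambda>\<omega>. g r \<omega> \<bullet> J r \<omega>))"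
    by (rule fubini_continuous_paths[OF st(2) gJ(1) gJ_cont gJ(2)])
  \<comment> \<open>At each time \<open>r\<close> the integrand pairs \<open>g r\<close>, known at
    time \<open>r\<close>, with the noise increment after \<open>r\<close>, so its mean is
    zero.\<close>
  have EZ2: "expectation Z2 = 0"
    unfolding Z2(4) using orth[OF _ g g2(1)] by (subst integral_cong[where g = "\<lambda>_. 0"]) auto
  have s: "s \<in> {s..t}" and t: "t \<in> {s..t}" using st by auto
  have wJ: "integrable M (\<lambda>\<omega>. w s \<omega> \<bullet> J s \<omega>)"
    using s by (intro integrable_inner_of_square wM JM w2 J2)
  have "AE \<omega> in M. (norm (w t \<omega>))\<^sup>2 =
    (norm (w s \<omega>))\<^sup>2 + 2 * Z1 \<omega> + 2 * Z2 \<omega> + 2 * (w s \<omega> \<bullet> J s \<omega>) + (norm (J s \<omega>))\<^sup>2"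
    using wcont gcont sol Z1(2) Z2(2)
  proof eventually_elim
    case (elim \<omega>)
    have J_eq: "J s \<omega> - G *v (W r \<omega> - W s \<omega>) = J r \<omega>" for r
      by (simp add: J_def matrix_vector_mult_diff_distrib)
    have J_s: "G *v (W t \<omega> - W s \<omega>) = J s \<omega>" by (simp add: J_def)
    show ?case
      using additive_path_energy[OF st(2) elim(2,1),
          where S = "\<lambda>r. G *v (W r \<omega> - W s \<omega>)", OF bspec[OF elim(3)]]
      unfolding J_s J_eq elim(4,5) by simp
  qed
  moreover have "(\<lambda>\<omega>. (norm (w t \<omega>))\<^sup>2) \<in> borel_measurable M"
    using wM[OF t] by measurable
  moreover have "(\<lambda>\<omega>. (norm (w s \<omega>))\<^sup>2 + 2 * Z1 \<omega> + 2 * Z2 \<omega> + 2 * (w s \<omega> \<bullet> J s \<omega>) + (norm (J s \<omega>))\<^sup>2)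
      \<in> borel_measurable M"
    using Z1(1) Z2(1) wJ w2(1)[OF s] J2(1)[OF s] by simp
  ultimately have "expectation (\<lambda>\<omega>. (norm (w t \<omega>))\<^sup>2) = expectation (\<lambda>\<omega>.
    (norm (w s \<omega>))\<^sup>2 + 2 * Z1 \<omega> + 2 * Z2 \<omega> + 2 * (w s \<omega> \<bullet> J s \<omega>) + (norm (J s \<omega>))\<^sup>2)"
    by (intro integral_cong_AE)
  also have "\<dots> = expectation (\<lambda>\<omega>. (norm (w s \<omega>))\<^sup>2) + 2 * expectation Z1 + 2 * expectation Z2
    + 2 * expectation (\<lambda>\<omega>. w s \<omega> \<bullet> J s \<omega>) + expectation (\<lambda>\<omega>. (norm (J s \<omega>))\<^sup>2)"
    using Z1(1) Z2(1) wJ w2(1)[OF s] J2(1)[OF s] by simp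
  finally show "expectation (\<lambda>\<omega>. (norm (w t \<omega>))\<^sup>2) = expectation (\<lambda>\<omega>. (norm (w s \<omega>))\<^sup>2)
      + 2 * integral {s..t} (\<lambda>r. expectation (\<lambda>\<omega>. w r \<omega> \<bullet> g r \<omega>)) + (t - s) * trace (G ** transpose G)"
    using EZ2 Z1(4) orth[OF s w[OF s] w2(1)[OF s]] J2(2)[OF s] by (simp add: \<tau>_def)
  show "(\<lambda>r. expectation (\<lambda>\<omega>. w r \<omega> \<bullet> g r \<omega>)) integrable_on {s..t}" by (rule Z1(3))
qed

end

section \<open>The mean-square estimate\<close>

text \<open>Writing \<open>J w\<close> as \<open>w\<close> minus its approximation error, the
  nudging damps by 2 \<mu> |w|^2, and Young's inequality returns half of it at the price of \<mu>
  c^2 times the squared V-norm. What is left of the viscous dissipation pays for the model error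
  \<open>e\<close>.\<close>

lemma nudged_dissipation:
  fixes w d e :: "real ^ 'd" and J :: "real ^ 'd \<Rightarrow> real ^ 'd"
  assumes diss: "linear_dissipation A lam" and mu: "0 \<le> \<mu>"
    and nueff: "0 < \<nu> - \<mu> * c\<^sup>2 / 2"
    and J: "norm (w - J w) \<le> c * V_norm A w"
    and d: "d \<bullet> w \<le> - \<nu> * (V_norm A w)\<^sup>2 + C * (norm w)\<^sup>2"
    and e: "norm e \<le> \<delta>"
  shows "2 * (w \<bullet> (d + e - \<mu> *\<^sub>R J w)) \<le>
    \<delta>\<^sup>2 / (lam * (\<nu> - \<mu> * c\<^sup>2 / 2)) - (\<mu> - 2 * C) * (norm w)\<^sup>2"
proof -
  define V where "V = V_norm A w"
  define n where "n = norm w"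
  define \<kappa> where "\<kappa> = \<nu> - \<mu> * c\<^sup>2 / 2"
  have lam: "0 < lam" using diss by (simp add: linear_dissipation_def)
  then have l\<kappa>: "0 < lam * \<kappa>" using nueff by (simp add: \<kappa>_def)
  have coer: "lam * n\<^sup>2 \<le> V\<^sup>2"
    unfolding n_def V_def by (rule linear_dissipation_coercive[OF diss])
  have "w \<bullet> (w - J w) \<le> n * (c * V)"
    using norm_cauchy_schwarz[of w "w - J w"] mult_left_mono[OF J norm_ge_zero[of w]]
    by (simp add: n_def V_def)
  then have "2 * (w \<bullet> (w - J w)) \<le> n\<^sup>2 + c\<^sup>2 * V\<^sup>2"
    using sum_squares_bound[of n "c * V"] by (simp add: power_mult_distrib)
  then have "\<mu> * (2 * (w \<bullet> (w - J w))) \<le> \<mu> * (n\<^sup>2 + c\<^sup>2 * V\<^sup>2)"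
    using mu by (rule mult_left_mono)
  then have 1: "- 2 * \<mu> * (w \<bullet> J w) \<le> - \<mu> * n\<^sup>2 + \<mu> * c\<^sup>2 * V\<^sup>2"
    by (simp add: inner_diff_right n_def power2_norm_eq_inner algebra_simps)
  have "w \<bullet> e \<le> n * \<delta>"
    using norm_cauchy_schwarz[of w e] mult_left_mono[OF e norm_ge_zero[of w]] by (simp add: n_def)
  moreover have "2 * (n * \<delta>) \<le> lam * \<kappa> * n\<^sup>2 + \<delta>\<^sup>2 / (lam * \<kappa>)"
  proof -
    \<comment> \<open>The Young weight \<open>lam * \<kappa>\<close> is chosen so that coercivity
      absorbs the quadratic term into \<kappa> V^2.\<close>
    define l where "l = lam * \<kappa>"
    have l: "0 < l" using l\<kappa> by (simp add: l_def)
    have "0 \<le> (l * n - \<delta>)\<^sup>2 / l" using l by simp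
    also have "\<dots> = l * n\<^sup>2 + \<delta>\<^sup>2 / l - 2 * (n * \<delta>)"
      using l by (simp only: power2_eq_square) (simp add: field_simps)
    finally show ?thesis by (simp add: l_def)
  qed
  moreover have "\<kappa> * (lam * n\<^sup>2) \<le> \<kappa> * V\<^sup>2"
    using coer nueff by (intro mult_left_mono) (auto simp: \<kappa>_def)
  \<comment> \<open>Absorbing the model error takes only half of the remaining dissipation 2
    \<kappa> V^2; the bound is relaxed to the full amount so that the V-terms cancel
    exactly.\<close>
  moreover have "0 \<le> \<kappa> * V\<^sup>2" using nueff by (simp add: \<kappa>_def)
  ultimately have 2: "2 * (w \<bullet> e) \<le> 2 * \<kappa> * V\<^sup>2 + \<delta>\<^sup>2 / (lam * \<kappa>)"
    by (simp add: algebra_simps)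
  have "2 * (w \<bullet> (d + e - \<mu> *\<^sub>R J w)) = 2 * (d \<bullet> w) + 2 * (w \<bullet> e) - 2 * \<mu> * (w \<bullet> J w)"
    by (simp add: inner_add_right inner_diff_right inner_commute algebra_simps)
  also have "\<dots> \<le> 2 * (- \<nu> * V\<^sup>2 + C * n\<^sup>2) + (2 * \<kappa> * V\<^sup>2 + \<delta>\<^sup>2 / (lam * \<kappa>)) + (- \<mu> * n\<^sup>2 + \<mu> * c\<^sup>2 * V\<^sup>2)"
    using d 1 2 by (simp add: V_def n_def)
  also have "\<dots> = \<delta>\<^sup>2 / (lam * \<kappa>) - (\<mu> - 2 * C) * n\<^sup>2"
    by (simp add: \<kappa>_def algebra_simps)
  finally show ?thesis by (simp add: \<kappa>_def n_def)
qed

lemma Limsup_of_exponential_bound: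
  fixes \<phi> :: "real \<Rightarrow> real"
  assumes \<gamma>: "0 < \<gamma>"
    and le: "\<And>t. s \<le> t \<Longrightarrow> \<phi> t \<le> exp (- \<gamma> * (t - s)) * a + (1 - exp (- \<gamma> * (t - s))) / \<gamma> * K"
  shows "Limsup at_top (\<lambda>t. ereal (\<phi> t)) \<le> ereal (1 / \<gamma> * K)"
proof -
  define B where "B t = exp (- \<gamma> * (t - s)) * a + (1 - exp (- \<gamma> * (t - s))) / \<gamma> * K" for t
  have "filterlim (\<lambda>t. \<gamma> * (t - s)) at_top at_top"
    using \<gamma> by (intro filterlim_tendsto_pos_mult_at_top[OF tendsto_const])
      (auto simp: filterlim_tendsto_add_at_top[OF tendsto_const filterlim_ident, of "- s", simplified])
  then have e: "((\<lambda>t. exp (- \<gamma> * (t - s))) \<longlongrightarrow> 0) at_top"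
    by (intro filterlim_compose[OF exp_at_bot]) (simp add: filterlim_uminus_at_top)
  have "(B \<longlongrightarrow> 0 * a + (1 - 0) / \<gamma> * K) at_top"
    unfolding B_def using \<gamma> by (intro tendsto_intros e) auto
  then have "Limsup at_top (\<lambda>t. ereal (B t)) = ereal (1 / \<gamma> * K)"
    by (intro lim_imp_Limsup) auto
  moreover have "Limsup at_top (\<lambda>t. ereal (\<phi> t)) \<le> Limsup at_top (\<lambda>t. ereal (B t))"
    by (intro Limsup_mono eventually_mono[OF eventually_ge_at_top[of s]]) (auto simp: B_def dest: le)
  ultimately show ?thesis by simp
qed

theorem theorem3p15:
  fixes \<nu> \<mu> lam1 c0 CI h Rext Rext' \<alpha>M \<beta>M CM Tstar Rstar \<delta>M \<gamma> \<nu>eff :: real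
    and \<psi> :: "real \<Rightarrow> real"
    and f u0 v0 :: "real ^ 'd"
    and A B :: "real ^ 'd ^ 'd"
    and N Fhat F FM :: "real ^ 'd \<Rightarrow> real ^ 'd"
    and G :: "(real ^ 'd) set"
    and I :: "real \<Rightarrow> real ^ 'd \<Rightarrow> real ^ 'd"
    and Oh :: "real ^ 'd \<Rightarrow> real ^ 'k"
    and Rh :: "real ^ 'k \<Rightarrow> real ^ 'd"
    and \<Sigma> :: "real ^ 'k ^ 'k"
    and \<Gamma> :: "real ^ 'k ^ 'd"
    and M :: "'w measure"
    and Fl :: "real \<Rightarrow> 'w measure"
    and W :: "real \<Rightarrow> 'w \<Rightarrow> real ^ 'k"
    and u vbar :: "real \<Rightarrow> real ^ 'd"
    and v :: "real \<Rightarrow> 'w \<Rightarrow> real ^ 'd"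
    and Bstar :: "(real ^ 'd) set"
  assumes nu_pos: "0 < \<nu>" and mu_pos: "0 < \<mu>" and h_range: "h \<in> {0..1}"
    and lin_diss: "linear_dissipation A lam1"
    and H_diss: "H_dissipative \<nu> A N"
    and nonlin: "nonlinearity_assumption N"
    and feedback: "feedback_operator A c0 CI I"
    and F_eq: "F = drift \<nu> f A N"
    and Rext: "0 < Rext" "Rext < Rext'"
    and cutoff: "cutoff_profile Rext Rext' \<psi>"
    and Fhat_nbhd: "open G" "{z. V_norm A z \<le> Rext'} \<subseteq> G"
    and Fhat_lip: "locally_lipschitz_on G Fhat"
    and B_spd: "sym_pos_def B"
    and FM_eq: "FM = cutoff_surrogate A \<psi> f B Fhat"
    and glob_diss: "0 < \<alpha>M" "0 \<le> \<beta>M" "\<And>z. FM z \<bullet> z \<le> \<beta>M - \<alpha>M * (norm z)\<^sup>2"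
      "0 < \<alpha>M - \<mu> * CI"
    and glob_squeeze: "0 \<le> CM"
      "\<And>z z'. (FM z' - FM z) \<bullet> (z' - z) \<le>
        - \<nu> * (V_norm A (z' - z))\<^sup>2 + CM * (norm (z' - z))\<^sup>2"
    and obs: "linear Oh" "linear Rh" "I h = Rh \<circ> Oh"
    and Gamma_eq: "\<Gamma> = matrix Rh ** \<Sigma>"
    and prob: "filtered_prob_space M Fl"
    and BM: "standard_brownian_motion M Fl W"
    and u_sol: "global_ode_solution (\<lambda>_. F) u0 u"
    and vbar_sol: "global_ode_solution (nudged_drift FM \<mu> (I h) u) v0 vbar"
    and v_sol: "strong_solution_additive M Fl W (nudged_drift FM \<mu> (I h) u) (\<mu> *\<^sub>R \<Gamma>) v0 v"
    and post_abs: "0 \<le> Tstar" "0 < Rstar"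
      "\<And>t. Tstar \<le> t \<Longrightarrow> V_norm A (u t) \<le> Rstar"
      "\<And>t. Tstar \<le> t \<Longrightarrow> V_norm A (vbar t) \<le> Rstar"
    and Bstar_eq: "Bstar = {z. V_norm A z \<le> Rstar}"
    and delta_fin: "bdd_above ((\<lambda>z. norm (FM z - F z)) ` Bstar)"
    and delta_eq: "\<delta>M = (SUP z\<in>Bstar. norm (FM z - F z))"
    and mu_large: "2 * CM < \<mu>" and mu_small: "\<mu> * c0\<^sup>2 * h\<^sup>2 < \<nu>"
    and gamma_eq: "\<gamma> = \<mu> - 2 * CM"
    and nueff_eq: "\<nu>eff = \<nu> - \<mu> * c0\<^sup>2 * h\<^sup>2 / 2"
  shows "0 < \<gamma> \<and> 0 < \<nu>eff \<and>
    (\<forall>t\<ge>Tstar.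
      integrable M (\<lambda>\<omega>. (norm (v t \<omega> - u t))\<^sup>2) \<and>
      (\<integral>\<omega>. (norm (v t \<omega> - u t))\<^sup>2 \<partial>M) \<le>
        exp (- \<gamma> * (t - Tstar)) * (\<integral>\<omega>. (norm (v Tstar \<omega> - u Tstar))\<^sup>2 \<partial>M) +
        (1 - exp (- \<gamma> * (t - Tstar))) / \<gamma> *
          (\<delta>M\<^sup>2 / (lam1 * \<nu>eff) + \<mu>\<^sup>2 * trace (\<Gamma> ** transpose \<Gamma>))) \<and>
    Limsup at_top (\<lambda>t. ereal (\<integral>\<omega>. (norm (v t \<omega> - u t))\<^sup>2 \<partial>M)) \<le>
      ereal (1 / \<gamma> * (\<delta>M\<^sup>2 / (lam1 * \<nu>eff) + \<mu>\<^sup>2 * trace (\<Gamma> ** transpose \<Gamma>)))"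
proof -
  interpret brownian M Fl W
    using prob BM by (intro brownian.intro brownian_axioms.intro) (auto simp: filtered_prob_space_def)
  define \<kappa> where "\<kappa> = trace (\<Gamma> ** transpose \<Gamma>)"
  define b where "b r z = nudged_drift FM \<mu> (I h) u r z" for r z
  define w where "w r \<omega> = v r \<omega> - u r" for r \<omega>
  define g where "g r \<omega> = b r (v r \<omega>) - F (u r)" for r \<omega>
  define \<phi> where "\<phi> r = expectation (\<lambda>\<omega>. (norm (w r \<omega>))\<^sup>2)" for r
  define K where "K = \<delta>M\<^sup>2 / (lam1 * \<nu>eff) + \<mu>\<^sup>2 * \<kappa>"
  have \<gamma>: "0 < \<gamma>" using mu_large gamma_eq by simp
  have \<nu>eff: "0 < \<nu>eff"
  proof -
    have "0 \<le> \<mu> * c0\<^sup>2 * h\<^sup>2" using mu_pos by simp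
    with mu_small have "\<mu> * c0\<^sup>2 * h\<^sup>2 / 2 < \<nu>" by linarith
    then show ?thesis by (simp add: nueff_eq)
  qed
  have spd: "sym_pos_def A" using lin_diss by (simp add: linear_dissipation_def)
  have Ih: "linear (I h)" and Ih_approx: "norm (z - I h z) \<le> c0 * h * V_norm A z"
    and Ih_bound: "norm (I h z) \<le> CI * norm z" and CI: "0 < CI" for z
    using feedback h_range by (auto simp: feedback_operator_def)

  \<comment> \<open>Continuity and growth of the drifts\<close>
  have R': "0 \<le> Rext'" using Rext by simp
  have FM_cont: "continuous_on T FM" for T
    using continuous_on_cutoff_surrogate[OF spd cutoff R' Fhat_nbhd Fhat_lip, of f B]
    unfolding FM_eq by (rule continuous_on_subset) simp
  obtain K0 where K0: "0 \<le> K0" "\<And>z. norm (FM z) \<le> K0 * (1 + norm z)"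
    using cutoff_surrogate_linear_growth[OF lin_diss cutoff R', of f B Fhat] FM_cont unfolding FM_eq by blast
  have "continuous_on UNIV N"
    using nonlin local_lipschitz_continuous_on[of UNIV UNIV "\<lambda>_. N" "0::real"]
    unfolding nonlinearity_assumption_def locally_lipschitz_on_def by simp
  moreover have "continuous_on UNIV ((*v) A)"
    by (intro linear_continuous_on matrix_vector_mul_bounded_linear)
  ultimately have "continuous_on UNIV F"
    unfolding F_eq drift_def by (intro continuous_intros)
  then have F_cont: "continuous_on T F" for T by (rule continuous_on_subset) simp
  have u': "(u has_vector_derivative F (u r)) (at r within T)" if "r \<in> T" "T \<subseteq> {0..}" for r T
    using u_sol that unfolding global_ode_solution_def
    by (auto intro: has_vector_derivative_within_subset)
  have u_cont: "continuous_on T u" if "T \<subseteq> {0..}" for T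
    using u' that by (intro continuous_on_vector_derivative) auto
  have Fu_cont: "continuous_on T (\<lambda>r. F (u r))" if "T \<subseteq> {0..}" for T
    by (rule continuous_on_compose2[OF F_cont u_cont[OF that]]) auto
  have b_cont: "continuous_on T (\<lambda>r. b r (x r))" if "T \<subseteq> {0..}" "continuous_on T x" for T x
    unfolding b_def nudged_drift_def using that
    by (intro continuous_intros u_cont continuous_on_compose2[OF FM_cont]
        linear_continuous_on_compose[OF _ Ih]) auto

  \<comment> \<open>The error process and its integral equation\<close>
  have v_adapted: "v r \<in> borel_measurable (Fl r)" if "0 \<le> r" for r
    using v_sol that by (simp add: strong_solution_additive_def adapted_process_def)
  have v_path: "AE \<omega> in M. continuous_on {0..} (\<lambda>t. v t \<omega>)"
    using v_sol by (simp add: strong_solution_additive_def)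
  have v_int: "AE \<omega> in M. \<forall>t\<ge>0. v t \<omega> = v0 + integral {0..t} (\<lambda>r. b r (v r \<omega>)) + (\<mu> *\<^sub>R \<Gamma>) *v (W t \<omega> - W 0 \<omega>)"
    using v_sol unfolding strong_solution_additive_def b_def by (auto elim: eventually_mono)
  have w_adapted: "w r \<in> borel_measurable (Fl r)" if "0 \<le> r" for r
    unfolding w_def using v_adapted[OF that] by measurable
  \<comment> \<open>Since \<open>u\<close> is deterministic, \<open>g r\<close> is a continuous
    function of \<open>v r\<close> at each fixed time and so inherits its measurability.\<close>
  have "continuous_on UNIV (\<lambda>z. b r z - F (u r))" for r
    unfolding b_def nudged_drift_def
    by (intro continuous_intros FM_cont linear_continuous_on_compose[OF _ Ih])
  then have g_adapted: "g r \<in> borel_measurable (Fl r)" if "0 \<le> r" for r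
    unfolding g_def using measurable_compose[OF v_adapted[OF that] borel_measurable_continuous_onI] by blast
  have w_cont: "AE \<omega> in M. continuous_on {s..t} (\<lambda>r. w r \<omega>)"
    and g_cont: "AE \<omega> in M. continuous_on {s..t} (\<lambda>r. g r \<omega>)" if "0 \<le> s" for s t
  proof -
    have sub: "{s..t} \<subseteq> {0..}" using that by auto
    show "AE \<omega> in M. continuous_on {s..t} (\<lambda>r. w r \<omega>)"
      using v_path unfolding w_def
      by eventually_elim (intro continuous_on_diff u_cont[OF sub] continuous_on_subset[OF _ sub])
    show "AE \<omega> in M. continuous_on {s..t} (\<lambda>r. g r \<omega>)"
      using v_path unfolding g_def
      by eventually_elim (intro continuous_on_diff Fu_cont[OF sub] b_cont[OF sub] continuous_on_subset[OF _ sub])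
  qed
  \<comment> \<open>The equation for \<open>v\<close> is posed from time 0. Subtracting its
    instances at \<open>r\<close> and \<open>s\<close> restarts it at \<open>s\<close>, and the
    fundamental theorem of calculus does the same for \<open>u\<close>.\<close>
  have w_int: "AE \<omega> in M. \<forall>r\<in>{s..t}. w r \<omega> = w s \<omega> + integral {s..r} (\<lambda>x. g x \<omega>) + (\<mu> *\<^sub>R \<Gamma>) *v (W r \<omega> - W s \<omega>)"
    if "0 \<le> s" for s t
    using v_int v_path
  proof eventually_elim
    case (elim \<omega>)
    show ?case
    proof
      fix r assume r: "r \<in> {s..t}"
      then have sub: "{0..r} \<subseteq> {0..}" "{s..r} \<subseteq> {0..}" and sr: "s \<le> r" "0 \<le> r" using that by auto
      note bc = b_cont[OF _ continuous_on_subset[OF elim(2)]]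
      have I: "integral {0..r} (\<lambda>x. b x (v x \<omega>)) = integral {0..s} (\<lambda>x. b x (v x \<omega>)) + integral {s..r} (\<lambda>x. b x (v x \<omega>))"
        by (rule Henstock_Kurzweil_Integration.integral_combine[symmetric])
          (use sub sr that bc in \<open>auto intro: integrable_continuous_real\<close>)
      have v_eq: "v r \<omega> = v s \<omega> + integral {s..r} (\<lambda>x. b x (v x \<omega>)) + (\<mu> *\<^sub>R \<Gamma>) *v (W r \<omega> - W s \<omega>)"
        unfolding elim(1)[rule_format, OF sr(2)] elim(1)[rule_format, OF that] I
        by (simp add: matrix_vector_mult_diff_distrib)
      have "((\<lambda>x. F (u x)) has_integral u r - u s) {s..r}"
        using u' sub sr by (intro fundamental_theorem_of_calculus) auto
      then have u_eq: "u r - u s = integral {s..r} (\<lambda>x. F (u x))" by (simp add: integral_unique)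
      have "integral {s..r} (\<lambda>x. g x \<omega>) = integral {s..r} (\<lambda>x. b x (v x \<omega>)) - integral {s..r} (\<lambda>x. F (u x))"
        unfolding g_def
        by (intro Henstock_Kurzweil_Integration.integral_diff integrable_continuous_real bc Fu_cont sub)
      with v_eq u_eq
      show "w r \<omega> = w s \<omega> + integral {s..r} (\<lambda>x. g x \<omega>) + (\<mu> *\<^sub>R \<Gamma>) *v (W r \<omega> - W s \<omega>)"
        by (simp add: w_def algebra_simps)
    qed
  qed

  \<comment> \<open>Second moments on bounded time intervals\<close>
  have moments: "\<exists>C. \<forall>r\<in>{0..T}. integrable M (\<lambda>\<omega>. (norm (w r \<omega>))\<^sup>2) \<and> expectation (\<lambda>\<omega>. (norm (w r \<omega>))\<^sup>2) \<le> C \<and>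
      integrable M (\<lambda>\<omega>. (norm (g r \<omega>))\<^sup>2) \<and> expectation (\<lambda>\<omega>. (norm (g r \<omega>))\<^sup>2) \<le> C" if T: "0 \<le> T" for T
  proof -
    have "bounded (u ` {0..T})" "bounded ((\<lambda>r. F (u r)) ` {0..T})"
      by (intro compact_imp_bounded compact_continuous_image u_cont Fu_cont; auto)+
    then obtain U U' where U: "0 < U" "\<And>r. r \<in> {0..T} \<Longrightarrow> norm (u r) \<le> U"
      and U': "0 < U'" "\<And>r. r \<in> {0..T} \<Longrightarrow> norm (F (u r)) \<le> U'"
      unfolding bounded_pos by auto
    \<comment> \<open>The three summands account for the surrogate, the feedback on the state, and
      the feedback on \<open>u\<close>, which is bounded by \<open>U\<close> on the
      interval.\<close>
    define K1 where "K1 = K0 + \<mu> * CI + \<mu> * CI * U"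
    have K1: "0 \<le> K1" using K0 mu_pos CI U by (simp add: K1_def)
    have b_growth: "norm (b r z) \<le> K1 * (1 + norm z)" if "r \<in> {0..T}" for r z
    proof -
      have "norm (b r z) \<le> norm (FM z) + \<mu> * norm (I h z - I h (u r))"
        unfolding b_def nudged_drift_def using norm_triangle_ineq4[of "FM z"] mu_pos by (metis abs_of_pos norm_scaleR)
      also have "\<dots> \<le> norm (FM z) + \<mu> * (norm (I h z) + norm (I h (u r)))"
        using mu_pos by (intro add_left_mono mult_left_mono norm_triangle_ineq4) auto
      also have "\<dots> \<le> K0 * (1 + norm z) + \<mu> * (CI * norm z + CI * U)"
        using mu_pos CI U(2)[OF that] order_trans[OF Ih_bound[of "u r"]]
        by (intro add_mono K0 mult_left_mono Ih_bound) auto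
      also have "\<dots> \<le> K1 * (1 + norm z)"
        using mu_pos CI U(1) by (simp add: K1_def algebra_simps)
      finally show ?thesis .
    qed
    have bv_cont: "AE \<omega> in M. continuous_on {0..T} (\<lambda>r. b r (v r \<omega>))"
      using v_path by eventually_elim (intro b_cont; auto elim: continuous_on_subset)
    have v_meas: "v r \<in> borel_measurable M" if "r \<in> {0..T}" for r
      using that by (intro adapted_measurable[OF v_adapted]) auto
    have v_int': "AE \<omega> in M. \<forall>r\<in>{0..T}.
        v r \<omega> = v0 + integral {0..r} (\<lambda>s. b s (v s \<omega>)) + (\<mu> *\<^sub>R \<Gamma>) *v (W r \<omega> - W 0 \<omega>)"
      using v_int by (rule eventually_mono) simp
    obtain C where "\<forall>r\<in>{0..T}. integrable M (\<lambda>\<omega>. (norm (v r \<omega>))\<^sup>2) \<and> expectation (\<lambda>\<omega>. (norm (v r \<omega>))\<^sup>2) \<le> C"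
      using square_integrable_additive_solution[OF T K1 v_meas bv_cont b_growth v_int'] by blast
    then have C: "integrable M (\<lambda>\<omega>. (norm (v r \<omega>))\<^sup>2)" "expectation (\<lambda>\<omega>. (norm (v r \<omega>))\<^sup>2) \<le> C"
      if "r \<in> {0..T}" for r
      using that by auto
    \<comment> \<open>One constant for both processes: \<open>w\<close> requires 1 and
      \<open>U\<close>, while \<open>g\<close> requires \<open>K1\<close> and the bound
      \<open>U'\<close> on the true drift along \<open>u\<close>.\<close>
    define K2 where "K2 = K1 + U + U' + 1"
    have bound: "integrable M (\<lambda>\<omega>. (norm (X \<omega>))\<^sup>2) \<and> expectation (\<lambda>\<omega>. (norm (X \<omega>))\<^sup>2) \<le> K2\<^sup>2 * (2 + 2 * C)"
      if X: "X \<in> borel_measurable M" and le: "\<And>\<omega>. norm (X \<omega>) \<le> K2 * (1 + norm (v r \<omega>))" and r: "r \<in> {0..T}"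
      for X :: "'w \<Rightarrow> real ^ 'd" and r
    proof -
      have pt: "(norm (X \<omega>))\<^sup>2 \<le> K2\<^sup>2 * (2 + 2 * (norm (v r \<omega>))\<^sup>2)" for \<omega>
      proof -
        have "(norm (X \<omega>))\<^sup>2 \<le> K2\<^sup>2 * (1 + norm (v r \<omega>))\<^sup>2"
          using power_mono[OF le[of \<omega>], of 2] by (simp add: power_mult_distrib)
        also have "\<dots> \<le> K2\<^sup>2 * (2 + 2 * (norm (v r \<omega>))\<^sup>2)"
          using norm_add_square_le[of 1 "norm (v r \<omega>)"] by (intro mult_left_mono) auto
        finally show ?thesis .
      qed
      have Bi: "integrable M (\<lambda>\<omega>. K2\<^sup>2 * (2 + 2 * (norm (v r \<omega>))\<^sup>2))" using C(1)[OF r] by simp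
      have Xi: "integrable M (\<lambda>\<omega>. (norm (X \<omega>))\<^sup>2)"
        using X order_trans[OF pt abs_ge_self] by (intro Bochner_Integration.integrable_bound[OF Bi]) auto
      have "expectation (\<lambda>\<omega>. (norm (X \<omega>))\<^sup>2) \<le> expectation (\<lambda>\<omega>. K2\<^sup>2 * (2 + 2 * (norm (v r \<omega>))\<^sup>2))"
        by (intro integral_mono Xi Bi pt)
      also have "\<dots> = K2\<^sup>2 * (2 + 2 * expectation (\<lambda>\<omega>. (norm (v r \<omega>))\<^sup>2))"
        using C(1)[OF r] by (simp add: prob_space)
      also have "\<dots> \<le> K2\<^sup>2 * (2 + 2 * C)"
        using C(2)[OF r] by (intro mult_left_mono) auto
      finally show ?thesis using Xi by simp
    qed
    have w_le: "norm (w r \<omega>) \<le> K2 * (1 + norm (v r \<omega>))" if r: "r \<in> {0..T}" for r \<omega>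
    proof -
      have "norm (w r \<omega>) \<le> norm (v r \<omega>) + U"
        using norm_triangle_ineq4[of "v r \<omega>" "u r"] U(2)[OF r] by (simp add: w_def)
      also have "\<dots> \<le> K2 * (1 + norm (v r \<omega>))"
        using K1 U(1) U'(1) by (simp add: K2_def algebra_simps add_nonneg_nonneg)
      finally show ?thesis .
    qed
    have g_le: "norm (g r \<omega>) \<le> K2 * (1 + norm (v r \<omega>))" if r: "r \<in> {0..T}" for r \<omega>
    proof -
      have "norm (g r \<omega>) \<le> K1 * (1 + norm (v r \<omega>)) + U'"
        using norm_triangle_ineq4[of "b r (v r \<omega>)" "F (u r)"] U'(2)[OF r] b_growth[OF r, of "v r \<omega>"]
        by (simp add: g_def)
      also have "\<dots> \<le> K2 * (1 + norm (v r \<omega>))"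
        using K1 U(1) U'(1) by (simp add: K2_def algebra_simps add_nonneg_nonneg)
      finally show ?thesis .
    qed
    show ?thesis
      using bound[OF adapted_measurable[OF w_adapted] w_le] bound[OF adapted_measurable[OF g_adapted] g_le]
      by (intro exI[of _ "K2\<^sup>2 * (2 + 2 * C)"]) auto
  qed

  \<comment> \<open>Pointwise dissipation of the error\<close>
  have dissip: "2 * (w r \<omega> \<bullet> g r \<omega>) \<le> \<delta>M\<^sup>2 / (lam1 * \<nu>eff) - \<gamma> * (norm (w r \<omega>))\<^sup>2" if r: "Tstar \<le> r" for r \<omega>
  proof -
    \<comment> \<open>The drift difference is split at \<open>FM (u r)\<close>. Global squeezing
      handles the surrogate at \<open>v\<close> against \<open>u\<close>, and the model error is
      evaluated only along \<open>u\<close>, which stays in \<open>Bstar\<close> after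
      \<open>Tstar\<close>; the noisy \<open>v\<close> may leave that set.\<close>
    have g_eq: "g r \<omega> = (FM (v r \<omega>) - FM (u r)) + (FM (u r) - F (u r)) - \<mu> *\<^sub>R I h (w r \<omega>)"
      by (simp add: g_def b_def nudged_drift_def w_def linear_diff[OF Ih])
    have e: "norm (FM (u r) - F (u r)) \<le> \<delta>M"
      unfolding delta_eq using post_abs(3)[OF r] delta_fin by (intro cSUP_upper) (simp_all add: Bstar_eq)
    have d: "(FM (v r \<omega>) - FM (u r)) \<bullet> w r \<omega> \<le> - \<nu> * (V_norm A (w r \<omega>))\<^sup>2 + CM * (norm (w r \<omega>))\<^sup>2"
      unfolding w_def by (rule glob_squeeze)
    have \<nu>eff': "\<nu>eff = \<nu> - \<mu> * (c0 * h)\<^sup>2 / 2"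
      by (simp add: nueff_eq power_mult_distrib)
    show ?thesis
      unfolding g_eq gamma_eq \<nu>eff'
      using mu_pos \<nu>eff by (intro nudged_dissipation[where J = "I h", OF lin_diss _ _ Ih_approx d e]) (simp_all add: \<nu>eff')
  qed
  have \<kappa>_scale: "trace ((\<mu> *\<^sub>R \<Gamma>) ** transpose (\<mu> *\<^sub>R \<Gamma>)) = \<mu>\<^sup>2 * \<kappa>"
    by (simp add: \<kappa>_def trace_mult_transpose power_mult_distrib sum_distrib_left)

  \<comment> \<open>The differential inequality in mean and its consequences\<close>
  have main: "\<phi> t \<le> exp (- \<gamma> * (t - Tstar)) * \<phi> Tstar + (1 - exp (- \<gamma> * (t - Tstar))) / \<gamma> * K"
    and int_w: "integrable M (\<lambda>\<omega>. (norm (w t \<omega>))\<^sup>2)" if t: "Tstar \<le> t" for t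
  proof -
    have t0: "0 \<le> t" using t post_abs(1) by simp
    obtain C where "\<forall>r\<in>{0..t}. integrable M (\<lambda>\<omega>. (norm (w r \<omega>))\<^sup>2) \<and> expectation (\<lambda>\<omega>. (norm (w r \<omega>))\<^sup>2) \<le> C \<and>
        integrable M (\<lambda>\<omega>. (norm (g r \<omega>))\<^sup>2) \<and> expectation (\<lambda>\<omega>. (norm (g r \<omega>))\<^sup>2) \<le> C"
      using moments[OF t0] by (rule exE)
    then have C: "integrable M (\<lambda>\<omega>. (norm (w r \<omega>))\<^sup>2)" "expectation (\<lambda>\<omega>. (norm (w r \<omega>))\<^sup>2) \<le> C"
      "integrable M (\<lambda>\<omega>. (norm (g r \<omega>))\<^sup>2)" "expectation (\<lambda>\<omega>. (norm (g r \<omega>))\<^sup>2) \<le> C" if "r \<in> {0..t}" for r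
      using that by auto
    show "integrable M (\<lambda>\<omega>. (norm (w t \<omega>))\<^sup>2)" using C(1) t0 by simp
    define \<eta> where "\<eta> r = expectation (\<lambda>\<omega>. w r \<omega> \<bullet> g r \<omega>)" for r
    have energy: "\<eta> integrable_on {a..c} \<and> \<phi> c = \<phi> a + 2 * integral {a..c} \<eta> + (c - a) * (\<mu>\<^sup>2 * \<kappa>)"
      if "0 \<le> a" "a \<le> c" "c \<le> t" for a c
    proof -
      have sub: "0 \<le> r" "r \<in> {0..t}" if "r \<in> {a..c}" for r using that \<open>0 \<le> a\<close> \<open>c \<le> t\<close> by auto
      show ?thesis
        unfolding \<eta>_def \<phi>_def \<kappa>_scale[symmetric]
        using additive_energy_identity[OF that(1,2) w_adapted[OF sub(1)] g_adapted[OF sub(1)] C(1)[OF sub(2)]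
            C(2)[OF sub(2)] C(3)[OF sub(2)] C(4)[OF sub(2)] w_cont[OF that(1)] g_cont[OF that(1)] w_int[OF that(1)]]
        by blast
    qed
    have \<eta>_le: "2 * \<eta> r \<le> \<delta>M\<^sup>2 / (lam1 * \<nu>eff) - \<gamma> * \<phi> r" if r: "Tstar \<le> r" "r \<le> t" for r
    proof -
      have r': "r \<in> {0..t}" "0 \<le> r" using r post_abs(1) by auto
      have "integrable M (\<lambda>\<omega>. w r \<omega> \<bullet> g r \<omega>)"
        using r' C w_adapted g_adapted by (intro integrable_inner_of_square adapted_measurable[of _ r]) auto
      then have "expectation (\<lambda>\<omega>. 2 * (w r \<omega> \<bullet> g r \<omega>)) \<le>
          expectation (\<lambda>\<omega>. \<delta>M\<^sup>2 / (lam1 * \<nu>eff) - \<gamma> * (norm (w r \<omega>))\<^sup>2)"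
        using C(1)[OF r'(1)] dissip[OF r(1)] by (intro integral_mono) auto
      then show ?thesis
        using C(1)[OF r'(1)] by (simp add: \<eta>_def \<phi>_def prob_space)
    qed
    \<comment> \<open>Continuity of the mean-square error is read off the energy identity, whose
      right-hand side is an indefinite integral plus an affine function of time.\<close>
    have "continuous_on {Tstar..t} (\<lambda>r. \<phi> Tstar + 2 * integral {Tstar..r} \<eta> + (r - Tstar) * (\<mu>\<^sup>2 * \<kappa>))"
      using energy[of Tstar t] post_abs(1) t
      by (intro continuous_intros indefinite_integral_continuous_1) auto
    then have \<phi>_cont: "continuous_on {Tstar..t} \<phi>"
    proof (rule continuous_on_eq)
      fix r assume "r \<in> {Tstar..t}"
      then show "\<phi> Tstar + 2 * integral {Tstar..r} \<eta> + (r - Tstar) * (\<mu>\<^sup>2 * \<kappa>) = \<phi> r"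
        using energy[OF post_abs(1), of r] by simp
    qed
    show "\<phi> t \<le> exp (- \<gamma> * (t - Tstar)) * \<phi> Tstar + (1 - exp (- \<gamma> * (t - Tstar))) / \<gamma> * K"
    proof (rule gronwall_decay[OF \<gamma> t \<phi>_cont])
      fix a c assume ac: "Tstar \<le> a" "a \<le> c" "c \<le> t"
      then have a0: "0 \<le> a" using post_abs(1) by simp
      note E = energy[OF a0 ac(2,3)]
      \<comment> \<open>The constant noise input is moved under the integral, where it joins the
        model-error term to form \<open>K\<close>.\<close>
      have i1: "(\<lambda>r. 2 * \<eta> r + \<mu>\<^sup>2 * \<kappa>) integrable_on {a..c}"
        using E by (intro integrable_add integrable_on_mult_right) auto
      have "integral {a..c} (\<lambda>r. 2 * \<eta> r + \<mu>\<^sup>2 * \<kappa>) = 2 * integral {a..c} \<eta> + (c - a) * (\<mu>\<^sup>2 * \<kappa>)"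
        using E ac(2) by (subst Henstock_Kurzweil_Integration.integral_add) (auto intro: integrable_on_mult_right)
      then have "\<phi> c - \<phi> a = integral {a..c} (\<lambda>r. 2 * \<eta> r + \<mu>\<^sup>2 * \<kappa>)"
        using conjunct2[OF E] by linarith
      also have "\<dots> \<le> integral {a..c} (\<lambda>r. K - \<gamma> * \<phi> r)"
      proof (rule integral_le[OF i1])
        show "(\<lambda>r. K - \<gamma> * \<phi> r) integrable_on {a..c}"
          using ac by (intro integrable_continuous_real continuous_intros continuous_on_subset[OF \<phi>_cont]) auto
        show "2 * \<eta> r + \<mu>\<^sup>2 * \<kappa> \<le> K - \<gamma> * \<phi> r" if "r \<in> {a..c}" for r
          using \<eta>_le[of r] that ac by (simp add: K_def)
      qed
      finally show "\<phi> c - \<phi> a \<le> integral {a..c} (\<lambda>r. K - \<gamma> * \<phi> r)" .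
    qed
  qed
  show ?thesis
    using \<gamma> \<nu>eff int_w main Limsup_of_exponential_bound[of \<gamma> Tstar \<phi>, OF \<gamma> main]
    unfolding \<phi>_def w_def K_def \<kappa>_def by blast
qed

end
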